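(* Let $(X,d)$ be a locally compact, separable, proper ultrametric space, let $m$ be a Radon measure on $X$ such that $m(B)>0$ for each ball $B$ of positive diameter and $m(\{x\})=0$ if and only if $x$ is a non-isolated point, and let $C:\mathcal B\to(0,\infty)$ be a choice function. For each $B'\in\mathcal B$ and each ball $B$ whose immediate predecessor is $B'$, put $$f_{B,B'}=\frac1{m(B)}\mathbf 1_B-\frac1{m(B')}\mathbf 1_{B'} .$$ Then: (1) the family of all functions $f_{B,B'}$ (together with the constant function $1/m(X)$ if $m(X)<\infty$) is a complete system in $L^2=L^2(X,m)$; (2) $L_C(f_{B,B'})(x)=\lambda(B')f_{B,B'}(x)$ for any $x\in X$ and any $B'\in\mathcal B$. In particular, $(L_C,\mathcal D)$ is a non-negative definite essentially self-adjoint operator in $L^2$.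
   Context: A metric is proper if all its closed balls are compact. Balls are sets $B_r(a)=\{x: d(x,a)<r\}$, $r>0$; $\mathcal B$ is the set of all non-singleton balls. The immediate predecessor $B'$ of a ball $B$ is the smallest ball strictly containing $B$. A system in $L^2$ is complete if its linear span is dense. A choice function is a function $C:\mathcal B\to(0,\infty)$ such that: (i) $\lambda(B):=\sum_{T\in\mathcal B:\,B\subseteq T}C(T)<\infty$ for every ball $B$; (ii) $\lim_{B\downarrow\{x\}}\lambda(B)=\infty$ (limit along balls $B\ni x$ shrinking to $\{x\}$) whenever $x$ is not an isolated point. $\mathcal D$ is the set of locally constant functions on $X$ with compact support, and the hierarchical Laplacian is defined pointwise by $$L_Cf(x)=-\sum_{B\in\mathcal B:\,x\in B}C(B)\bigl(P_Bf-f(x)\bigr),\qquad f\in\mathcal D,\qquad P_Bf=\frac1{m(B)}\int_B f\,dm .$$ *)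

theory Defs
  imports "HOL-Analysis.Analysis"
begin

section \<open>Balls in an ultrametric space\<close>

definition ultrametric :: "'a::metric_space itself \<Rightarrow> bool" where
  "ultrametric _ \<longleftrightarrow> (\<forall>x y z :: 'a. dist x z \<le> max (dist x y) (dist y z))"

definition proper_metric :: "'a::metric_space itself \<Rightarrow> bool" where
  "proper_metric _ \<longleftrightarrow> (\<forall>(x::'a) r. compact (cball x r))"

definition all_balls :: "'a::metric_space set set" where
  "all_balls = {ball a r |a r. 0 < r}"

definition nontrivial_balls :: "'a::metric_space set set" where
  "nontrivial_balls = {B \<in> all_balls. \<not> is_singleton B}"

text \<open>The ball \<open>B\<close> may be a singleton here (the ball of an isolated point); \<open>B'\<close> never is.\<close>
definition immediate_predecessor :: "'a::metric_space set \<Rightarrow> 'a set \<Rightarrow> bool" where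
  "immediate_predecessor B' B \<longleftrightarrow>
     B \<in> all_balls \<and> B' \<in> all_balls \<and> B \<subset> B' \<and> (\<forall>T\<in>all_balls. B \<subset> T \<longrightarrow> B' \<subseteq> T)"

text \<open>The filter of balls \<open>B\<close> containing \<open>x\<close> and shrinking to \<open>{x}\<close>.\<close>
definition balls_down_to :: "'a::metric_space \<Rightarrow> 'a set filter" where
  "balls_down_to x = (INF r\<in>{0<..}. principal {B \<in> all_balls. x \<in> B \<and> B \<subseteq> ball x r})"

definition radon_measure :: "'a::topological_space measure \<Rightarrow> bool" where
  "radon_measure M \<longleftrightarrow>
     sets M = sets borel \<and>
     (\<forall>K. compact K \<longrightarrow> emeasure M K < \<infinity>) \<and>
     (\<forall>A\<in>sets borel. emeasure M A = (INF U\<in>{U. open U \<and> A \<subseteq> U}. emeasure M U)) \<and>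
     (\<forall>U. open U \<longrightarrow> emeasure M U = (SUP K\<in>{K. compact K \<and> K \<subseteq> U}. emeasure M K))"

section \<open>Choice functions and the hierarchical Laplacian\<close>

definition hlambda :: "('a::metric_space set \<Rightarrow> real) \<Rightarrow> 'a set \<Rightarrow> real" where
  "hlambda C B = (\<Sum>\<^sub>\<infinity>T\<in>{T \<in> nontrivial_balls. B \<subseteq> T}. C T)"

definition choice_function :: "('a::metric_space set \<Rightarrow> real) \<Rightarrow> bool" where
  "choice_function C \<longleftrightarrow>
     (\<forall>B\<in>nontrivial_balls. 0 < C B) \<and>
     (\<forall>B\<in>all_balls. C summable_on {T \<in> nontrivial_balls. B \<subseteq> T}) \<and>
     (\<forall>x. \<not> x isolated_in UNIV \<longrightarrow> filterlim (hlambda C) at_top (balls_down_to x))"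

definition locally_constant :: "('a::topological_space \<Rightarrow> 'b) \<Rightarrow> bool" where
  "locally_constant f \<longleftrightarrow> (\<forall>x. \<exists>U. open U \<and> x \<in> U \<and> f constant_on U)"

definition test_functions :: "('a::metric_space \<Rightarrow> real) set" where
  "test_functions = {f. locally_constant f \<and> compact (closure {x. f x \<noteq> 0})}"

definition ball_average :: "'a measure \<Rightarrow> 'a set \<Rightarrow> ('a \<Rightarrow> real) \<Rightarrow> real" where
  "ball_average M B f = (1 / measure M B) * (LINT x:B|M. f x)"

text \<open>For a test function \<open>f\<close> the series converges absolutely: the terms vanish for the balls
  around \<open>x\<close> on which \<open>f\<close> is constant, and over the remaining balls it is dominated by a multiple
  of some \<open>hlambda C B\<close>.\<close>
definition hierarchical_laplacian ::
  "'a::metric_space measure \<Rightarrow> ('a set \<Rightarrow> real) \<Rightarrow> ('a \<Rightarrow> real) \<Rightarrow> 'a \<Rightarrow> real" where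
  "hierarchical_laplacian M C f x =
     - (\<Sum>\<^sub>\<infinity>B\<in>{B \<in> nontrivial_balls. x \<in> B}. C B * (ball_average M B f - f x))"

definition haar_fun :: "'a measure \<Rightarrow> 'a set \<Rightarrow> 'a set \<Rightarrow> 'a \<Rightarrow> real" where
  "haar_fun M B B' x =
     (1 / measure M B) * indicator B x - (1 / measure M B') * indicator B' x"

definition haar_system :: "'a::metric_space measure \<Rightarrow> ('a \<Rightarrow> real) set" where
  "haar_system M =
     {haar_fun M B B' |B B'. B' \<in> nontrivial_balls \<and> immediate_predecessor B' B} \<union>
     (if emeasure M (space M) < \<infinity> then {\<lambda>_. 1 / measure M (space M)} else {})"

section \<open>Systems and operators in the real space \<open>L\<^sup>2\<close>\<close>

text \<open>Elements of \<open>L\<^sup>2\<close> are given by their representatives. Operators are identified with their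
  graphs, which are saturated under equality almost everywhere.\<close>

definition L2 :: "'a measure \<Rightarrow> ('a \<Rightarrow> real) set" where
  "L2 M = {f \<in> borel_measurable M. integrable M (\<lambda>x. (f x)\<^sup>2)}"

definition L2_inner :: "'a measure \<Rightarrow> ('a \<Rightarrow> real) \<Rightarrow> ('a \<Rightarrow> real) \<Rightarrow> real" where
  "L2_inner M f g = (LINT x|M. f x * g x)"

definition L2_dist :: "'a measure \<Rightarrow> ('a \<Rightarrow> real) \<Rightarrow> ('a \<Rightarrow> real) \<Rightarrow> real" where
  "L2_dist M f g = sqrt (LINT x|M. (f x - g x)\<^sup>2)"

definition L2_dense :: "'a measure \<Rightarrow> ('a \<Rightarrow> real) set \<Rightarrow> bool" where
  "L2_dense M S \<longleftrightarrow> S \<subseteq> L2 M \<and> (\<forall>g\<in>L2 M. \<forall>e>0. \<exists>h\<in>S. L2_dist M g h < e)"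

definition linear_span :: "('a \<Rightarrow> real) set \<Rightarrow> ('a \<Rightarrow> real) set" where
  "linear_span F = {(\<lambda>x. \<Sum>f\<in>S. c f * f x) |S c. finite S \<and> S \<subseteq> F}"

definition complete_system :: "'a measure \<Rightarrow> ('a \<Rightarrow> real) set \<Rightarrow> bool" where
  "complete_system M F \<longleftrightarrow> F \<subseteq> L2 M \<and> L2_dense M (linear_span F)"

definition L2_operator ::
  "'a measure \<Rightarrow> (('a \<Rightarrow> real) \<Rightarrow> ('a \<Rightarrow> real)) \<Rightarrow> ('a \<Rightarrow> real) set \<Rightarrow> bool" where
  "L2_operator M A D \<longleftrightarrow>
     D \<subseteq> L2 M \<and> D \<noteq> {} \<and> (\<forall>f\<in>D. A f \<in> L2 M) \<and>
     (\<forall>f\<in>D. \<forall>g\<in>D. (AE x in M. f x = g x) \<longrightarrow> (AE x in M. A f x = A g x)) \<and>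
     (\<forall>f\<in>D. \<forall>g\<in>D. \<forall>a b. (\<lambda>x. a * f x + b * g x) \<in> D \<and>
        (AE x in M. A (\<lambda>y. a * f y + b * g y) x = a * A f x + b * A g x))"

definition nonneg_definite ::
  "'a measure \<Rightarrow> (('a \<Rightarrow> real) \<Rightarrow> ('a \<Rightarrow> real)) \<Rightarrow> ('a \<Rightarrow> real) set \<Rightarrow> bool" where
  "nonneg_definite M A D \<longleftrightarrow> (\<forall>f\<in>D. 0 \<le> L2_inner M (A f) f)"

definition symmetric_operator ::
  "'a measure \<Rightarrow> (('a \<Rightarrow> real) \<Rightarrow> ('a \<Rightarrow> real)) \<Rightarrow> ('a \<Rightarrow> real) set \<Rightarrow> bool" where
  "symmetric_operator M A D \<longleftrightarrow> (\<forall>f\<in>D. \<forall>g\<in>D. L2_inner M (A f) g = L2_inner M f (A g))"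

definition L2_graph ::
  "'a measure \<Rightarrow> (('a \<Rightarrow> real) \<Rightarrow> ('a \<Rightarrow> real)) \<Rightarrow> ('a \<Rightarrow> real) set
     \<Rightarrow> (('a \<Rightarrow> real) \<times> ('a \<Rightarrow> real)) set" where
  "L2_graph M A D =
     {(f, g). f \<in> L2 M \<and> g \<in> L2 M \<and>
        (\<exists>u\<in>D. (AE x in M. f x = u x) \<and> (AE x in M. g x = A u x))}"

definition graph_closure ::
  "'a measure \<Rightarrow> (('a \<Rightarrow> real) \<times> ('a \<Rightarrow> real)) set \<Rightarrow> (('a \<Rightarrow> real) \<times> ('a \<Rightarrow> real)) set" where
  "graph_closure M G =
     {(f, g). f \<in> L2 M \<and> g \<in> L2 M \<and>
        (\<forall>e>0. \<exists>(u, v)\<in>G. L2_dist M f u < e \<and> L2_dist M g v < e)}"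

definition graph_adjoint ::
  "'a measure \<Rightarrow> (('a \<Rightarrow> real) \<times> ('a \<Rightarrow> real)) set \<Rightarrow> (('a \<Rightarrow> real) \<times> ('a \<Rightarrow> real)) set" where
  "graph_adjoint M G =
     {(f, g). f \<in> L2 M \<and> g \<in> L2 M \<and> (\<forall>(u, v)\<in>G. L2_inner M v f = L2_inner M u g)}"

text \<open>Density of the domain makes the adjoint single-valued, so that equality of the closure with
  its adjoint says that the closure is (the graph of) a self-adjoint operator.\<close>
definition essentially_self_adjoint ::
  "'a measure \<Rightarrow> (('a \<Rightarrow> real) \<Rightarrow> ('a \<Rightarrow> real)) \<Rightarrow> ('a \<Rightarrow> real) set \<Rightarrow> bool" where
  "essentially_self_adjoint M A D \<longleftrightarrow>
     L2_operator M A D \<and> L2_dense M D \<and> symmetric_operator M A D \<and>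
     graph_adjoint M (graph_closure M (L2_graph M A D)) = graph_closure M (L2_graph M A D)"

end

theory Submission
  imports Defs
begin

text \<open>The Haar functions \<open>f\<^bsub>B,B'\<^esub>\<close> are eigenfunctions because, with \<open>h\<^sub>S = 1\<^sub>S/m(S)\<close>, one has
  \<open>L h\<^sub>B = \<Sum> C(T) (h\<^sub>B - h\<^sub>T)\<close> over the balls \<open>T\<close> strictly containing \<open>B\<close>; subtracting the same
  formula for \<open>B'\<close> leaves \<open>\<lambda>(B') (h\<^sub>B - h\<^bsub>B'\<^esub>)\<close>. Telescoping along the finitely many balls between
  \<open>B\<close> and a large ball \<open>T\<close> puts \<open>h\<^sub>B - h\<^sub>T\<close> in the span of the Haar functions, and \<open>h\<^sub>T\<close> tends to
  the constant \<open>1/m(X)\<close> in \<open>L\<^sup>2\<close>, or to \<open>0\<close>, as \<open>T\<close> grows to \<open>X\<close>; this gives completeness.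
  The form \<open>\<langle>L f, g\<rangle> = \<Sum> C(T) \<langle>f - P\<^sub>T f, g\<rangle>\<close>, with the inner product on the right taken in
  \<open>L\<^sup>2(T)\<close>, shows symmetry and non-negativity. The range of \<open>L + 1\<close> contains the Haar functions, and
  approximates constants if \<open>m(X) < \<infinity>\<close>, so it is dense; for a non-negative symmetric operator this
  implies essential self-adjointness.\<close>

section \<open>Geometry of \<open>L\<^sup>2\<close>\<close>

text \<open>Two obstacles shape the proof. L of a ball indicator is an infinite sum whose support is
  in general not compact, so even its square-integrability has to be proved: the sum is truncated to
  the balls inside a growing ball, the truncations are bounded in L2 uniformly, and Fatou's lemma
  passes to the limit. And if m(X) is finite while X is not compact, the constants are not test
  functions; they are approximated by (L + 1) 1_T for growing T, where the norm of L 1_T is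
  controlled by a tail of the convergent series of the \<open>C\<close> over the balls strictly
  containing a fixed one. For this reason the density criterion asks for the constants only in the
  closure of the subspace, and it is applied twice: to the span of the Haar system and to the range
  of L + 1. Statements linear in a test function are reduced to ball indicators by an induction
  rule, since a test function is a finite linear combination of these.\<close>

definition L2_norm :: "'a measure \<Rightarrow> ('a \<Rightarrow> real) \<Rightarrow> real" where
  "L2_norm M f = sqrt (LINT x|M. (f x)\<^sup>2)"

definition function_subspace :: "('a \<Rightarrow> real) set \<Rightarrow> bool" where
  "function_subspace S \<longleftrightarrow>
     (\<lambda>_. 0) \<in> S \<and> (\<forall>f\<in>S. \<forall>g\<in>S. \<forall>a b. (\<lambda>x. a * f x + b * g x) \<in> S)"

text \<open>Elements are functions and \<open>L2_dist\<close> is only a pseudometric on them, so the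
  closure contains with a function all its square-integrable a.e. modifications. Density becomes an
  inclusion into this set, which can be checked on generators because the closure of a subspace is a
  subspace.\<close>

definition L2_closure :: "'a measure \<Rightarrow> ('a \<Rightarrow> real) set \<Rightarrow> ('a \<Rightarrow> real) set" where
  "L2_closure M S = {f \<in> L2 M. \<forall>e>0. \<exists>h\<in>S. L2_dist M f h < e}"

lemma L2_dist_norm: "L2_dist M f g = L2_norm M (\<lambda>x. f x - g x)"
  by (simp add: L2_dist_def L2_norm_def)

lemma L2_measurable: "f \<in> L2 M \<Longrightarrow> f \<in> borel_measurable M"
  by (simp add: L2_def)

lemma L2_integrable_mult:
  assumes f: "f \<in> L2 M" and g: "g \<in> L2 M"
  shows "integrable M (\<lambda>x. f x * g x)"
proof (rule Bochner_Integration.integrable_bound)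
  show "integrable M (\<lambda>x. (f x)\<^sup>2 + (g x)\<^sup>2)"
    using f g by (auto simp: L2_def)
  show "(\<lambda>x. f x * g x) \<in> borel_measurable M"
    using f g by (auto simp: L2_def)
  show "AE x in M. norm (f x * g x) \<le> norm ((f x)\<^sup>2 + (g x)\<^sup>2)"
  proof (rule AE_I2)
    fix x
    have "0 \<le> (\<bar>f x\<bar> - \<bar>g x\<bar>)\<^sup>2" by simp
    also have "\<dots> = (f x)\<^sup>2 + (g x)\<^sup>2 - 2 * \<bar>f x * g x\<bar>"
      by (simp add: power2_diff abs_mult)
    finally show "norm (f x * g x) \<le> norm ((f x)\<^sup>2 + (g x)\<^sup>2)"
      using abs_ge_zero[of "f x * g x"] by (simp only: real_norm_def)
  qed
qed

lemma L2_lincomb: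
  assumes f: "f \<in> L2 M" and g: "g \<in> L2 M"
  shows "(\<lambda>x. a * f x + b * g x) \<in> L2 M"
proof -
  have "integrable M (\<lambda>x. a\<^sup>2 * (f x)\<^sup>2 + b\<^sup>2 * (g x)\<^sup>2 + 2 * a * b * (f x * g x))"
    using f g L2_integrable_mult[OF f g] by (auto simp: L2_def)
  moreover have "a\<^sup>2 * (f x)\<^sup>2 + b\<^sup>2 * (g x)\<^sup>2 + 2 * a * b * (f x * g x) = (a * f x + b * g x)\<^sup>2" for x
    by (simp add: power2_sum power_mult_distrib)
  ultimately show ?thesis
    using f g by (auto simp: L2_def)
qed

lemma L2_zero: "(\<lambda>_. 0) \<in> L2 M"
  by (simp add: L2_def)

lemma L2_scale: "f \<in> L2 M \<Longrightarrow> (\<lambda>x. a * f x) \<in> L2 M"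
  using L2_lincomb[of f M f a 0] by simp

lemma L2_add: "f \<in> L2 M \<Longrightarrow> g \<in> L2 M \<Longrightarrow> (\<lambda>x. f x + g x) \<in> L2 M"
  using L2_lincomb[of f M g 1 1] by simp

lemma L2_diff: "f \<in> L2 M \<Longrightarrow> g \<in> L2 M \<Longrightarrow> (\<lambda>x. f x - g x) \<in> L2 M"
  using L2_lincomb[of f M g 1 "-1"] by simp

lemma function_subspace_L2: "function_subspace (L2 M)"
  by (simp add: function_subspace_def L2_zero L2_lincomb)

lemma L2_norm_sq: "(L2_norm M f)\<^sup>2 = L2_inner M f f"
  by (simp add: L2_norm_def L2_inner_def power2_eq_square)

lemma L2_norm_nonneg: "0 \<le> L2_norm M f"
  by (simp add: L2_norm_def)

lemma L2_norm_scale: "L2_norm M (\<lambda>x. a * f x) = \<bar>a\<bar> * L2_norm M f"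
  by (simp add: L2_norm_def power_mult_distrib real_sqrt_mult)

lemma L2_inner_commute: "L2_inner M f g = L2_inner M g f"
  by (simp add: L2_inner_def mult.commute)

lemma L2_inner_lincomb:
  assumes "f \<in> L2 M" "g \<in> L2 M" "h \<in> L2 M"
  shows "L2_inner M (\<lambda>x. a * f x + b * g x) h = a * L2_inner M f h + b * L2_inner M g h"
proof -
  have "(a * f x + b * g x) * h x = a * (f x * h x) + b * (g x * h x)" for x
    by (simp add: algebra_simps)
  then show ?thesis
    using L2_integrable_mult[OF assms(1,3)] L2_integrable_mult[OF assms(2,3)]
    by (simp add: L2_inner_def)
qed

lemma L2_inner_add_left:
  assumes "f \<in> L2 M" "g \<in> L2 M" "h \<in> L2 M"
  shows "L2_inner M (\<lambda>x. f x + g x) h = L2_inner M f h + L2_inner M g h"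
  using L2_inner_lincomb[OF assms, of 1 1] by simp

lemma L2_inner_diff_left:
  assumes "f \<in> L2 M" "g \<in> L2 M" "h \<in> L2 M"
  shows "L2_inner M (\<lambda>x. f x - g x) h = L2_inner M f h - L2_inner M g h"
  using L2_inner_lincomb[OF assms, of 1 "-1"] by simp

lemma L2_inner_add_right:
  assumes "f \<in> L2 M" "g \<in> L2 M" "h \<in> L2 M"
  shows "L2_inner M h (\<lambda>x. f x + g x) = L2_inner M h f + L2_inner M h g"
  using L2_inner_add_left[OF assms] by (simp add: L2_inner_commute[of M h])

lemma L2_inner_diff_right:
  assumes "f \<in> L2 M" "g \<in> L2 M" "h \<in> L2 M"
  shows "L2_inner M h (\<lambda>x. f x - g x) = L2_inner M h f - L2_inner M h g"
  using L2_inner_diff_left[OF assms] by (simp add: L2_inner_commute[of M h])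

lemma L2_inner_cong_AE:
  assumes "f \<in> L2 M" "f' \<in> L2 M" "g \<in> L2 M" "g' \<in> L2 M"
    and "AE x in M. f x = f' x" "AE x in M. g x = g' x"
  shows "L2_inner M f g = L2_inner M f' g'"
  unfolding L2_inner_def
proof (rule integral_cong_AE)
  show "AE x in M. f x * g x = f' x * g' x"
    using assms(5,6) by eventually_elim simp
qed (use assms(1-4) in \<open>auto simp: L2_def\<close>)

lemma L2_norm_cong_AE:
  assumes "f \<in> L2 M" "g \<in> L2 M" "AE x in M. f x = g x"
  shows "L2_norm M f = L2_norm M g"
proof -
  have "(L2_norm M f)\<^sup>2 = (L2_norm M g)\<^sup>2"
    unfolding L2_norm_sq using assms by (intro L2_inner_cong_AE) auto
  then show ?thesis
    by (simp add: L2_norm_nonneg)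
qed

text \<open>The squared norm of t f + s g is a non-negative quadratic form in (t, s). Keeping both
  variables avoids a division: \<open>t = - c\<close>, \<open>s = a\<^sup>2\<close> turns it into
  \<open>a\<^sup>2 * (a\<^sup>2 * b\<^sup>2 - c\<^sup>2)\<close>, where the first factor cancels
  unless it is zero.\<close>

lemma L2_Cauchy_Schwarz:
  assumes f: "f \<in> L2 M" and g: "g \<in> L2 M"
  shows "\<bar>L2_inner M f g\<bar> \<le> L2_norm M f * L2_norm M g"
proof -
  have *: "0 \<le> t\<^sup>2 * (L2_norm M f)\<^sup>2 + 2 * t * s * L2_inner M f g + s\<^sup>2 * (L2_norm M g)\<^sup>2" for t s
  proof -
    have "(\<lambda>x. t * f x + s * g x) \<in> L2 M" by (rule L2_lincomb[OF f g])
    note h = this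
    have "L2_inner M f (\<lambda>x. t * f x + s * g x) = t * L2_inner M f f + s * L2_inner M f g"
      "L2_inner M g (\<lambda>x. t * f x + s * g x) = t * L2_inner M f g + s * L2_inner M g g"
      using L2_inner_lincomb[OF f g f, of t s] L2_inner_lincomb[OF f g g, of t s]
      by (simp_all add: L2_inner_commute[of M _ "\<lambda>x. t * f x + s * g x"] L2_inner_commute[of M g f])
    then have "L2_inner M (\<lambda>x. t * f x + s * g x) (\<lambda>x. t * f x + s * g x) =
        t\<^sup>2 * (L2_norm M f)\<^sup>2 + 2 * t * s * L2_inner M f g + s\<^sup>2 * (L2_norm M g)\<^sup>2"
      unfolding L2_inner_lincomb[OF f g h] L2_norm_sq by (simp add: power2_eq_square distrib_left)
    then show ?thesis
      by (metis L2_norm_sq zero_le_power2)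
  qed
  define a b c where "a = L2_norm M f" and "b = L2_norm M g" and "c = L2_inner M f g"
  have nn: "0 \<le> a" "0 \<le> b" by (auto simp: a_def b_def L2_norm_nonneg)
  have q: "0 \<le> t\<^sup>2 * a\<^sup>2 + 2 * t * s * c + s\<^sup>2 * b\<^sup>2" for t s
    using * by (simp add: a_def b_def c_def)
  have "c\<^sup>2 \<le> (a * b)\<^sup>2"
  proof (cases "a = 0")
    case True
    have "c = 0"
    proof (rule ccontr)
      assume "c \<noteq> 0"
      \<comment> \<open>For \<open>a = 0\<close> and \<open>s = 1\<close> the form is the affine
        function 2tc + b^2 of t; this t makes it equal to -1.\<close>
      with q[of "- (b\<^sup>2 + 1) / (2 * c)" 1] True have "0 \<le> - (b\<^sup>2 + 1) + b\<^sup>2"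
        by (simp add: field_simps)
      then show False by simp
    qed
    then show ?thesis by simp
  next
    case False
    have "0 \<le> a\<^sup>2 * (a\<^sup>2 * b\<^sup>2 - c\<^sup>2)"
      using q[of "-c" "a\<^sup>2"] by (simp add: algebra_simps power2_eq_square)
    with False show ?thesis
      by (simp add: zero_le_mult_iff power_mult_distrib)
  qed
  then have "\<bar>c\<bar> \<le> a * b"
    using nn by (metis abs_le_square_iff abs_of_nonneg mult_nonneg_nonneg)
  then show ?thesis
    by (simp add: a_def b_def c_def)
qed

lemma L2_norm_triangle:
  assumes f: "f \<in> L2 M" and g: "g \<in> L2 M"
  shows "L2_norm M (\<lambda>x. f x + g x) \<le> L2_norm M f + L2_norm M g"
proof (rule power2_le_imp_le)
  have fg: "(\<lambda>x. f x + g x) \<in> L2 M" by (rule L2_add[OF f g])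
  have "(L2_norm M (\<lambda>x. f x + g x))\<^sup>2 =
      (L2_norm M f)\<^sup>2 + 2 * L2_inner M f g + (L2_norm M g)\<^sup>2"
    using f g fg by (simp add: L2_norm_sq L2_inner_add_left L2_inner_add_right
        L2_inner_commute[of M g f])
  also have "\<dots> \<le> (L2_norm M f + L2_norm M g)\<^sup>2"
    using L2_Cauchy_Schwarz[OF f g] by (simp add: power2_sum)
  finally show "(L2_norm M (\<lambda>x. f x + g x))\<^sup>2 \<le> (L2_norm M f + L2_norm M g)\<^sup>2" .
qed (simp add: L2_norm_nonneg)

lemma L2_dist_triangle:
  assumes "f \<in> L2 M" "g \<in> L2 M" "h \<in> L2 M"
  shows "L2_dist M f h \<le> L2_dist M f g + L2_dist M g h"
  using L2_norm_triangle[OF L2_diff[OF assms(1,2)] L2_diff[OF assms(2,3)]]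
  by (simp add: L2_dist_norm)

lemma L2_dist_commute: "L2_dist M f g = L2_dist M g f"
  by (simp add: L2_dist_def power2_commute)

lemma L2_dist_nonneg: "0 \<le> L2_dist M f g"
  by (simp add: L2_dist_norm L2_norm_nonneg)

section \<open>Closures, subspaces and density in L2\<close>

lemma L2_closure_superset: "S \<subseteq> L2 M \<Longrightarrow> S \<subseteq> L2_closure M S"
  unfolding L2_closure_def L2_dist_def by (auto intro!: bexI)

lemma L2_closure_idem:
  assumes S: "S \<subseteq> L2 M"
    and f: "f \<in> L2 M" "\<And>e. 0 < e \<Longrightarrow> \<exists>h\<in>L2_closure M S. L2_dist M f h < e"
  shows "f \<in> L2_closure M S"
proof -
  have "\<exists>h\<in>S. L2_dist M f h < e" if "0 < e" for e
  proof -
    obtain h where h: "h \<in> L2_closure M S" "L2_dist M f h < e / 2"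
      using f(2)[of "e / 2"] \<open>0 < e\<close> by auto
    then obtain k where k: "k \<in> S" "L2_dist M h k < e / 2"
      using \<open>0 < e\<close> unfolding L2_closure_def by (auto dest: spec[of _ "e / 2"])
    have "L2_dist M f k \<le> L2_dist M f h + L2_dist M h k"
      using f h k S by (intro L2_dist_triangle) (auto simp: L2_closure_def)
    with h k show ?thesis by force
  qed
  with f show ?thesis by (auto simp: L2_closure_def)
qed

lemma L2_closure_LIMSEQ:
  assumes S: "S \<subseteq> L2 M" and f: "f \<in> L2 M"
    and u: "\<forall>\<^sub>F n in sequentially. u n \<in> L2_closure M S"
    and lim: "(\<lambda>n. L2_dist M f (u n)) \<longlonglongrightarrow> 0"
  shows "f \<in> L2_closure M S"
proof (rule L2_closure_idem[OF S f])
  fix e :: real assume "0 < e"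
  from order_tendstoD(2)[OF lim this] u
  have "\<forall>\<^sub>F n in sequentially. u n \<in> L2_closure M S \<and> L2_dist M f (u n) < e"
    by eventually_elim simp
  then obtain n where "u n \<in> L2_closure M S" "L2_dist M f (u n) < e"
    using eventually_happens'[OF sequentially_bot] by blast
  then show "\<exists>h\<in>L2_closure M S. L2_dist M f h < e" by blast
qed

lemma function_subspace_L2_closure:
  assumes S: "S \<subseteq> L2 M" "function_subspace S"
  shows "function_subspace (L2_closure M S)"
  unfolding function_subspace_def
proof (intro conjI ballI allI)
  show "(\<lambda>_. 0) \<in> L2_closure M S"
    using S L2_closure_superset by (auto simp: function_subspace_def)
next
  fix f g and a b :: real
  assume fg: "f \<in> L2_closure M S" "g \<in> L2_closure M S"
  then have fgL: "f \<in> L2 M" "g \<in> L2 M" by (auto simp: L2_closure_def)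
  have "\<exists>h\<in>S. L2_dist M (\<lambda>x. a * f x + b * g x) h < e" if "0 < e" for e
  proof -
    \<comment> \<open>The summand 1 keeps the denominator positive when both coefficients vanish,
      and it makes the final estimate strict.\<close>
    define d where "d = e / (\<bar>a\<bar> + \<bar>b\<bar> + 1)"
    have d: "0 < d" "(\<bar>a\<bar> + \<bar>b\<bar>) * d < e" using \<open>0 < e\<close> by (auto simp: d_def field_simps)
    obtain u v where uv: "u \<in> S" "v \<in> S" "L2_dist M f u < d" "L2_dist M g v < d"
      using fg d unfolding L2_closure_def by blast
    then have uvL: "u \<in> L2 M" "v \<in> L2 M" using S by auto
    have eq: "L2_dist M (\<lambda>x. a * f x + b * g x) (\<lambda>x. a * u x + b * v x) =
        L2_norm M (\<lambda>x. a * (f x - u x) + b * (g x - v x))"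
      by (simp add: L2_dist_norm algebra_simps)
    also have "\<dots> \<le> \<bar>a\<bar> * L2_dist M f u + \<bar>b\<bar> * L2_dist M g v"
      using L2_norm_triangle[OF L2_scale[OF L2_diff[OF fgL(1) uvL(1)], of a]
          L2_scale[OF L2_diff[OF fgL(2) uvL(2)], of b]]
      by (simp add: L2_norm_scale L2_dist_norm)
    also have "\<dots> \<le> (\<bar>a\<bar> + \<bar>b\<bar>) * d"
      using uv by (auto simp: distrib_right intro!: add_mono mult_left_mono)
    finally show ?thesis
      using d uv S by (intro bexI[of _ "\<lambda>x. a * u x + b * v x"]) (auto simp: function_subspace_def)
  qed
  then show "(\<lambda>x. a * f x + b * g x) \<in> L2_closure M S"
    by (simp add: L2_closure_def L2_lincomb[OF fgL])
qed

lemma L2_dense_iff_closure: "L2_dense M S \<longleftrightarrow> S \<subseteq> L2 M \<and> L2 M \<subseteq> L2_closure M S"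
  by (auto simp: L2_dense_def L2_closure_def)

lemma L2_dense_subset_closure:
  assumes "L2_dense M D" "S \<subseteq> L2 M" "D \<subseteq> L2_closure M S"
  shows "L2_dense M S"
  unfolding L2_dense_iff_closure
proof (intro conjI subsetI)
  fix f assume f: "f \<in> L2 M"
  show "f \<in> L2_closure M S"
    by (rule L2_closure_idem) (use assms f in \<open>auto simp: L2_dense_def, blast\<close>)
qed (use assms in auto)

lemma function_subspace_add_scale:
  assumes "function_subspace S" "f \<in> S" "g \<in> S"
  shows "(\<lambda>x. a * f x + b * g x) \<in> S"
  using assms by (auto simp: function_subspace_def)

lemma function_subspace_zero: "function_subspace S \<Longrightarrow> (\<lambda>_. 0) \<in> S"
  by (simp add: function_subspace_def)

lemma function_subspace_sum:
  assumes S: "function_subspace S" and "finite I" "\<And>i. i \<in> I \<Longrightarrow> f i \<in> S"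
  shows "(\<lambda>x. \<Sum>i\<in>I. c i * f i x) \<in> S"
  using assms(2,3)
proof (induction I rule: finite_induct)
  case empty
  then show ?case using S by (simp add: function_subspace_def)
next
  case (insert i I)
  from function_subspace_add_scale[OF S, of "f i" "\<lambda>x. \<Sum>i\<in>I. c i * f i x" "c i" 1] insert
  show ?case by simp
qed

lemma linear_span_subset:
  assumes "function_subspace S" "F \<subseteq> S"
  shows "linear_span F \<subseteq> S"
proof
  fix f assume "f \<in> linear_span F"
  then obtain I c where "f = (\<lambda>x. \<Sum>h\<in>I. c h * h x)" "finite I" "I \<subseteq> F"
    unfolding linear_span_def by blast
  with assms show "f \<in> S"
    using function_subspace_sum[OF assms(1), of I "\<lambda>h. h" c] by auto
qed

lemma linear_span_superset: "F \<subseteq> linear_span F"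
proof
  fix f assume "f \<in> F"
  then show "f \<in> linear_span F"
    unfolding linear_span_def
    by (intro CollectI exI[of _ "{f}"] exI[of _ "\<lambda>_. 1"]) auto
qed

lemma function_subspace_linear_span: "function_subspace (linear_span F)"
  unfolding function_subspace_def
proof (intro conjI ballI allI)
  show "(\<lambda>_. 0) \<in> linear_span F"
    unfolding linear_span_def by (intro CollectI exI[of _ "{}"]) auto
next
  fix f g and a b :: real
  assume "f \<in> linear_span F" "g \<in> linear_span F"
  then obtain S c T d where
    f: "f = (\<lambda>x. \<Sum>h\<in>S. c h * h x)" "finite S" "S \<subseteq> F" and
    g: "g = (\<lambda>x. \<Sum>h\<in>T. d h * h x)" "finite T" "T \<subseteq> F"
    unfolding linear_span_def by blast
  \<comment> \<open>Both combinations are rewritten over the union of their index sets, with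
    coefficients extended by zero.\<close>
  define c' where "c' h = (if h \<in> S then c h else 0)" for h
  define d' where "d' h = (if h \<in> T then d h else 0)" for h
  have fe: "f x = (\<Sum>h\<in>S \<union> T. c' h * h x)" for x
    unfolding f using f g by (intro sum.mono_neutral_cong_left) (auto simp: c'_def)
  have ge: "g x = (\<Sum>h\<in>S \<union> T. d' h * h x)" for x
    unfolding g using f g by (intro sum.mono_neutral_cong_left) (auto simp: d'_def)
  have "a * f x + b * g x = (\<Sum>h\<in>S \<union> T. (a * c' h + b * d' h) * h x)" for x
    by (simp add: fe ge sum_distrib_left sum.distrib distrib_right mult.assoc)
  then show "(\<lambda>x. a * f x + b * g x) \<in> linear_span F"
    unfolding linear_span_def using f g
    by (intro CollectI exI[of _ "S \<union> T"] exI[of _ "\<lambda>h. a * c' h + b * d' h"]) auto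
qed

lemma L2_indicator:
  assumes "A \<in> sets M" "emeasure M A < \<infinity>"
  shows "indicator A \<in> L2 M"
proof -
  have "(indicator A x)\<^sup>2 = (indicator A x :: real)" for x
    by (simp add: indicator_def)
  then show ?thesis
    using assms by (simp add: L2_def)
qed

lemma L2_dist_indicator:
  assumes "A \<in> sets M" "B \<in> sets M"
  shows "L2_dist M (indicator A) (indicator B) = sqrt (measure M ((A - B) \<union> (B - A)))"
proof -
  have "(LINT x|M. (indicator A x - indicator B x)\<^sup>2) =
      (LINT x|M. indicator ((A - B) \<union> (B - A)) x :: real)"
    by (intro Bochner_Integration.integral_cong) (auto simp: indicator_def)
  also have "\<dots> = measure M ((A - B) \<union> (B - A))"
    using assms sets.sets_into_space[of A M] sets.sets_into_space[of B M]
    by (simp add: Int_absorb2 le_supI Diff_subset subset_trans)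
  finally show ?thesis
    by (simp add: L2_dist_def)
qed

text \<open>Simple functions that converge pointwise to g and are dominated by
  \<open>2 * \<bar>g x\<bar>\<close> converge to g in L2 by dominated convergence, and a
  square-integrable simple function is a combination of indicators of level sets of finite
  measure.\<close>

lemma L2_dense_if_indicators:
  assumes S: "S \<subseteq> L2 M" "function_subspace S"
    and ind: "\<And>A. A \<in> sets M \<Longrightarrow> emeasure M A < \<infinity> \<Longrightarrow> indicator A \<in> L2_closure M S"
  shows "L2_dense M S"
  unfolding L2_dense_iff_closure
proof (intro conjI S(1) subsetI[of "L2 M"])
  fix g assume g: "g \<in> L2 M"
  then have gm[measurable]: "g \<in> borel_measurable M" by (simp add: L2_def)
  have gi: "integrable M (\<lambda>x. (g x)\<^sup>2)" using g by (simp add: L2_def)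
  obtain s where s: "\<And>i. simple_function M (s i)"
    and lim: "\<And>x. x \<in> space M \<Longrightarrow> (\<lambda>i. s i x) \<longlonglongrightarrow> g x"
    and bd: "\<And>i x. x \<in> space M \<Longrightarrow> dist (s i x) 0 \<le> 2 * dist (g x) 0"
    using borel_measurable_implies_sequence_metric[OF gm, of 0] by blast
  have bd': "\<bar>s i x\<bar> \<le> 2 * \<bar>g x\<bar>" if "x \<in> space M" for i x
    using bd[OF that, of i] by simp
  have sm[measurable]: "s i \<in> borel_measurable M" for i
    using s by (rule borel_measurable_simple_function)
  have sL: "s i \<in> L2 M" for i
  proof -
    have "integrable M (\<lambda>x. (s i x)\<^sup>2)"
    proof (rule Bochner_Integration.integrable_bound)
      show "integrable M (\<lambda>x. 4 * (g x)\<^sup>2)" using gi by simp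
      show "AE x in M. norm ((s i x)\<^sup>2) \<le> norm (4 * (g x)\<^sup>2)"
      proof (rule AE_I2)
        fix x assume "x \<in> space M"
        have "\<bar>s i x\<bar> \<le> \<bar>2 * g x\<bar>" using bd'[OF \<open>x \<in> space M\<close>, of i] by linarith
        then have "(s i x)\<^sup>2 \<le> (2 * g x)\<^sup>2" by (simp only: abs_le_square_iff)
        then show "norm ((s i x)\<^sup>2) \<le> norm (4 * (g x)\<^sup>2)" by (simp add: power_mult_distrib)
      qed
    qed measurable
    then show ?thesis by (simp add: L2_def)
  qed
  have sc: "s i \<in> L2_closure M S" for i
  proof -
    have fin: "finite (s i ` space M)" using s[of i] by (auto simp: simple_function_def)
    have sets: "s i -` {y} \<inter> space M \<in> sets M" for y
      using s[of i] by (auto simp: simple_functionD(2))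
    \<comment> \<open>Chebyshev's inequality: on the level set of y the indicator equals
      \<open>(s i x)\<^sup>2 / y\<^sup>2\<close>, so it is integrable. The level set of 0 may have
      infinite measure and is left out of the sum.\<close>
    have mem: "indicator (s i -` {y} \<inter> space M) \<in> L2_closure M S" if "y \<noteq> 0" for y
    proof (rule ind[OF sets])
      have "integrable M (\<lambda>x. (1 / y\<^sup>2) * (s i x)\<^sup>2)" using sL[of i] by (simp add: L2_def)
      then have "integrable M (indicator (s i -` {y} \<inter> space M) :: _ \<Rightarrow> real)"
        by (rule Bochner_Integration.integrable_bound)
          (use sets[of y] that in \<open>auto intro!: AE_I2 simp: indicator_def\<close>)
      then show "emeasure M (s i -` {y} \<inter> space M) < \<infinity>"
        using sets[of y] by (simp add: integrable_indicator_iff)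
    qed
    have c: "(\<lambda>x. \<Sum>y\<in>s i ` space M - {0}. y * indicator (s i -` {y} \<inter> space M) x) \<in> L2_closure M S"
      by (rule function_subspace_sum[OF function_subspace_L2_closure[OF S]]) (use fin mem in auto)
    have e: "s i x = (\<Sum>y\<in>s i ` space M - {0}. y * indicator (s i -` {y} \<inter> space M) x)"
      if "x \<in> space M" for x
    proof (cases "s i x = 0")
      case True
      then have "(\<Sum>y\<in>s i ` space M - {0}. y * indicator (s i -` {y} \<inter> space M) x) = 0"
        by (intro sum.neutral) (auto simp: indicator_def)
      then show ?thesis using True by simp
    next
      case False
      have "(\<Sum>y\<in>s i ` space M - {0}. y * indicator (s i -` {y} \<inter> space M) x) =
          (\<Sum>y\<in>{s i x}. y * indicator (s i -` {y} \<inter> space M) x)"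
        using False fin that by (intro sum.mono_neutral_right) (auto simp: indicator_def)
      then show ?thesis using that by simp
    qed
    \<comment> \<open>The combination of indicators agrees with \<open>s i\<close> on
      \<open>space M\<close> only, so membership in the closure comes from a distance 0 and not from
      an equality of functions.\<close>
    define h where "h x = (\<Sum>y\<in>s i ` space M - {0}. y * indicator (s i -` {y} \<inter> space M) x)" for x
    have hc: "h \<in> L2_closure M S" using c by (simp only: h_def[abs_def])
    have eh: "s i x = h x" if "x \<in> space M" for x
      unfolding h_def by (rule e[OF that])
    show ?thesis
    proof (rule L2_closure_idem[OF S(1) sL])
      fix e :: real assume "0 < e"
      have "L2_dist M (s i) h = sqrt (LINT x|M. 0)"
        unfolding L2_dist_def
        by (intro arg_cong[of _ _ sqrt] Bochner_Integration.integral_cong) (use eh in auto)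
      with \<open>0 < e\<close> show "\<exists>h\<in>L2_closure M S. L2_dist M (s i) h < e"
        by (intro bexI[OF _ hc]) simp
    qed
  qed
  have "(\<lambda>i. LINT x|M. (g x - s i x)\<^sup>2) \<longlonglongrightarrow> (LINT x|M. 0)"
  proof (rule integral_dominated_convergence)
    \<comment> \<open>The dominating function is (|g| + 2|g|)^2.\<close>
    show "integrable M (\<lambda>x. 9 * (g x)\<^sup>2)" using gi by simp
    show "AE x in M. (\<lambda>i. (g x - s i x)\<^sup>2) \<longlonglongrightarrow> 0"
    proof (rule AE_I2)
      fix x assume "x \<in> space M"
      have "(\<lambda>i. (g x - s i x)\<^sup>2) \<longlonglongrightarrow> (g x - g x)\<^sup>2"
        by (intro tendsto_intros lim[OF \<open>x \<in> space M\<close>])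
      then show "(\<lambda>i. (g x - s i x)\<^sup>2) \<longlonglongrightarrow> 0" by simp
    qed
    show "AE x in M. norm ((g x - s i x)\<^sup>2) \<le> 9 * (g x)\<^sup>2" for i
    proof (rule AE_I2)
      fix x assume "x \<in> space M"
      have "\<bar>g x - s i x\<bar> \<le> \<bar>3 * g x\<bar>" using bd'[OF \<open>x \<in> space M\<close>, of i] by linarith
      then have "(g x - s i x)\<^sup>2 \<le> (3 * g x)\<^sup>2" by (simp only: abs_le_square_iff)
      then show "norm ((g x - s i x)\<^sup>2) \<le> 9 * (g x)\<^sup>2" by (simp add: power_mult_distrib)
    qed
  qed measurable
  then have "(\<lambda>i. sqrt (LINT x|M. (g x - s i x)\<^sup>2)) \<longlonglongrightarrow> sqrt 0"
    by (intro tendsto_real_sqrt) simp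
  then have "(\<lambda>i. L2_dist M g (s i)) \<longlonglongrightarrow> 0"
    by (simp add: L2_dist_def)
  then show "g \<in> L2_closure M S"
    using sc by (intro L2_closure_LIMSEQ[OF S(1) g]) auto
qed

text \<open>Fatou's lemma for the squares. It serves to place L of a ball indicator, a pointwise
  limit of finite sums, in L2 together with a bound on its norm.\<close>

lemma L2_Fatou:
  fixes u :: "nat \<Rightarrow> 'b \<Rightarrow> real"
  assumes u: "\<And>n. u n \<in> L2 M" and lim: "\<And>x. x \<in> space M \<Longrightarrow> (\<lambda>n. u n x) \<longlonglongrightarrow> f x"
    and bd: "\<And>n. (LINT x|M. (u n x)\<^sup>2) \<le> c"
  shows "f \<in> L2 M" and "(LINT x|M. (f x)\<^sup>2) \<le> c"
proof -
  have um[measurable]: "u n \<in> borel_measurable M" for n using u[of n] by (rule L2_measurable)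
  have fm[measurable]: "f \<in> borel_measurable M"
    using borel_measurable_LIMSEQ_real[OF lim um] .
  have "0 \<le> (LINT x|M. (u 0 x)\<^sup>2)" by simp
  then have c: "0 \<le> c" using bd[of 0] by linarith
  have "(\<integral>\<^sup>+x. ennreal ((f x)\<^sup>2) \<partial>M) = (\<integral>\<^sup>+x. liminf (\<lambda>n. ennreal ((u n x)\<^sup>2)) \<partial>M)"
  proof (rule nn_integral_cong)
    fix x assume "x \<in> space M"
    from lim[OF this] have "(\<lambda>n. ennreal ((u n x)\<^sup>2)) \<longlonglongrightarrow> ennreal ((f x)\<^sup>2)"
      by (intro tendsto_ennrealI tendsto_power)
    then show "ennreal ((f x)\<^sup>2) = liminf (\<lambda>n. ennreal ((u n x)\<^sup>2))"
      by (intro lim_imp_Liminf[symmetric] sequentially_bot)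
  qed
  also have "\<dots> \<le> liminf (\<lambda>n. \<integral>\<^sup>+x. ennreal ((u n x)\<^sup>2) \<partial>M)"
    by (rule nn_integral_liminf) measurable
  also have "\<dots> \<le> liminf (\<lambda>n::nat. ennreal c)"
  proof (intro Liminf_mono always_eventually allI)
    fix n
    have "(\<integral>\<^sup>+x. ennreal ((u n x)\<^sup>2) \<partial>M) = ennreal (LINT x|M. (u n x)\<^sup>2)"
      using u[of n] by (intro nn_integral_eq_integral) (auto simp: L2_def)
    then show "(\<integral>\<^sup>+x. ennreal ((u n x)\<^sup>2) \<partial>M) \<le> ennreal c"
      using bd[of n] by (simp add: ennreal_leI)
  qed
  finally have le: "(\<integral>\<^sup>+x. ennreal ((f x)\<^sup>2) \<partial>M) \<le> ennreal c"
    by (simp add: Liminf_const)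
  then have int: "integrable M (\<lambda>x. (f x)\<^sup>2)"
    by (intro integrableI_bounded) (auto simp: less_top[symmetric] top_unique)
  then show "f \<in> L2 M" by (simp add: L2_def)
  have "(\<integral>\<^sup>+x. ennreal ((f x)\<^sup>2) \<partial>M) = ennreal (LINT x|M. (f x)\<^sup>2)"
    using int by (intro nn_integral_eq_integral) auto
  with le c show "(LINT x|M. (f x)\<^sup>2) \<le> c" by (simp add: ennreal_le_iff)
qed

section \<open>A criterion for essential self-adjointness\<close>

text \<open>\<open>L2_graph\<close> is saturated under equality almost everywhere, and distances do
  not see null sets; hence approximating pairs may be taken of the exact form (u, A u) with u in
  D.\<close>

lemma graph_closure_iff:
  assumes "f \<in> L2 M" "g \<in> L2 M" "L2_operator M A D"
  shows "(f, g) \<in> graph_closure M (L2_graph M A D) \<longleftrightarrow>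
    (\<forall>e>0. \<exists>u\<in>D. L2_dist M f u < e \<and> L2_dist M g (A u) < e)"
proof -
  have D: "u \<in> L2 M" "A u \<in> L2 M" if "u \<in> D" for u
    using assms(3) that by (auto simp: L2_operator_def)
  have "(\<exists>(u, v)\<in>L2_graph M A D. L2_dist M f u < e \<and> L2_dist M g v < e) \<longleftrightarrow>
      (\<exists>u\<in>D. L2_dist M f u < e \<and> L2_dist M g (A u) < e)" for e
  proof
    assume "\<exists>u\<in>D. L2_dist M f u < e \<and> L2_dist M g (A u) < e"
    then show "\<exists>(u, v)\<in>L2_graph M A D. L2_dist M f u < e \<and> L2_dist M g v < e"
      using D by (force simp: L2_graph_def)
  next
    assume "\<exists>(u, v)\<in>L2_graph M A D. L2_dist M f u < e \<and> L2_dist M g v < e"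
    then obtain u v w where uv: "u \<in> L2 M" "v \<in> L2 M" "w \<in> D" "AE x in M. u x = w x"
       "AE x in M. v x = A w x" "L2_dist M f u < e" "L2_dist M g v < e"
      by (auto simp: L2_graph_def)
    have "L2_dist M f u = L2_dist M f w"
      unfolding L2_dist_norm using uv D assms
      by (intro L2_norm_cong_AE L2_diff) (auto elim: eventually_mono)
    moreover have "L2_dist M g v = L2_dist M g (A w)"
      unfolding L2_dist_norm using uv D assms
      by (intro L2_norm_cong_AE L2_diff) (auto elim: eventually_mono)
    ultimately show "\<exists>u\<in>D. L2_dist M f u < e \<and> L2_dist M g (A u) < e"
      using uv by auto
  qed
  then show ?thesis
    using assms by (auto simp: graph_closure_def)
qed

text \<open>For \<open>(f, g)\<close> in the adjoint, approximate \<open>f + g\<close> by \<open>(A + 1) u\<close>. Then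
  \<open>\<langle>(A + 1) w, f - u\<rangle> = \<langle>w, f + g - (A + 1) u\<rangle>\<close> for all \<open>w\<close> in \<open>D\<close>, and since
  \<open>\<parallel>w\<parallel> \<le> \<parallel>(A + 1) w\<parallel>\<close> and the range of \<open>A + 1\<close> is dense, \<open>u\<close> is close to \<open>f\<close>.\<close>

lemma essentially_self_adjointI:
  assumes op: "L2_operator M A D"
    and dense: "L2_dense M D"
    and sym: "symmetric_operator M A D"
    and nonneg: "nonneg_definite M A D"
    and range: "L2_dense M ((\<lambda>u x. A u x + u x) ` D)"
  shows "essentially_self_adjoint M A D"
proof -
  let ?G = "L2_graph M A D"
  have D: "u \<in> L2 M" "A u \<in> L2 M" "(\<lambda>x. A u x + u x) \<in> L2 M" if "u \<in> D" for u
    using op that by (auto simp: L2_operator_def intro!: L2_add)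
  have "graph_adjoint M (graph_closure M ?G) = graph_closure M ?G"
  proof (intro set_eqI iffI; clarify)
    fix f g assume fg: "(f, g) \<in> graph_closure M ?G"
    then have fgL: "f \<in> L2 M" "g \<in> L2 M" by (auto simp: graph_closure_def)
    have "L2_inner M v f = L2_inner M u g" if uv: "(u, v) \<in> graph_closure M ?G" for u v
    proof -
      have uvL: "u \<in> L2 M" "v \<in> L2 M" using uv by (auto simp: graph_closure_def)
      \<comment> \<open>Symmetry is carried to the closure one argument at a time. Here (u, v) is
        replaced by a pair (p, A p) while w stays in D, at a cost proportional to e.\<close>
      have 1: "\<bar>L2_inner M v w - L2_inner M u (A w)\<bar> \<le> e * (L2_norm M w + L2_norm M (A w))"
        if w: "w \<in> D" and "0 < e" for w e
      proof -
        obtain p where p: "p \<in> D" "L2_dist M u p < e" "L2_dist M v (A p) < e"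
          using uv \<open>0 < e\<close> uvL op by (auto simp: graph_closure_iff)
        have "L2_inner M (A p) w = L2_inner M p (A w)"
          using sym p w by (auto simp: symmetric_operator_def)
        then have "L2_inner M v w - L2_inner M u (A w) =
            L2_inner M (\<lambda>x. v x - A p x) w - L2_inner M (\<lambda>x. u x - p x) (A w)"
          using uvL D p w by (simp add: L2_inner_diff_left)
        also have "\<bar>\<dots>\<bar> \<le> L2_dist M v (A p) * L2_norm M w + L2_dist M u p * L2_norm M (A w)"
          unfolding L2_dist_norm using uvL D p w
          by (intro order_trans[OF abs_triangle_ineq4] add_mono L2_Cauchy_Schwarz L2_diff) auto
        also have "\<dots> \<le> e * L2_norm M w + e * L2_norm M (A w)"
          using p by (intro add_mono mult_right_mono) (auto simp: L2_norm_nonneg)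
        finally show ?thesis by (simp add: distrib_left)
      qed
      have 2: "L2_inner M v w = L2_inner M u (A w)" if w: "w \<in> D" for w
      proof -
        define K where "K = L2_norm M w + L2_norm M (A w)"
        have K: "0 \<le> K" by (simp add: K_def L2_norm_nonneg)
        have "\<bar>L2_inner M v w - L2_inner M u (A w)\<bar> \<le> 0"
        proof (rule field_le_epsilon)
          fix e :: real assume "0 < e"
          have "\<bar>L2_inner M v w - L2_inner M u (A w)\<bar> \<le> e / (K + 1) * K"
            using 1[OF w, of "e / (K + 1)"] K \<open>0 < e\<close> by (simp add: K_def)
          also have "\<dots> \<le> e" using K \<open>0 < e\<close> by (simp add: field_simps)
          finally show "\<bar>L2_inner M v w - L2_inner M u (A w)\<bar> \<le> 0 + e" by simp
        qed
        then show ?thesis by simp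
      qed
      \<comment> \<open>Now (f, g) is replaced by a pair (w, A w), for which equality has just been
        shown; K collects the norms that multiply the two errors.\<close>
      define K where "K = L2_norm M u + L2_norm M v"
      have K: "0 \<le> K" by (simp add: K_def L2_norm_nonneg)
      have "\<bar>L2_inner M v f - L2_inner M u g\<bar> \<le> 0"
      proof (rule field_le_epsilon)
        fix e :: real assume "0 < e"
        then have e': "0 < e / (K + 1)" using K by simp
        obtain w where w: "w \<in> D" "L2_dist M f w < e / (K + 1)" "L2_dist M g (A w) < e / (K + 1)"
          using fg e' fgL op by (auto simp: graph_closure_iff)
        have "L2_inner M v f - L2_inner M u g =
            L2_inner M v (\<lambda>x. f x - w x) - L2_inner M u (\<lambda>x. g x - A w x)"
          using uvL fgL D w 2[OF w(1)] by (simp add: L2_inner_diff_right)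
        also have "\<bar>\<dots>\<bar> \<le> L2_norm M v * L2_dist M f w + L2_norm M u * L2_dist M g (A w)"
          unfolding L2_dist_norm using uvL fgL D w
          by (intro order_trans[OF abs_triangle_ineq4] add_mono L2_Cauchy_Schwarz L2_diff) auto
        also have "\<dots> \<le> L2_norm M v * (e / (K + 1)) + L2_norm M u * (e / (K + 1))"
          using w by (intro add_mono mult_left_mono) (auto simp: L2_norm_nonneg)
        also have "\<dots> = K * (e / (K + 1))" by (simp add: K_def algebra_simps add_divide_distrib)
        also have "\<dots> \<le> e" using K \<open>0 < e\<close> by (simp add: field_simps)
        finally show "\<bar>L2_inner M v f - L2_inner M u g\<bar> \<le> 0 + e" by simp
      qed
      then show ?thesis by simp
    qed
    then show "(f, g) \<in> graph_adjoint M (graph_closure M ?G)"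
      using fgL by (auto simp: graph_adjoint_def)
  next
    fix f g assume fg: "(f, g) \<in> graph_adjoint M (graph_closure M ?G)"
    then have fgL: "f \<in> L2 M" "g \<in> L2 M" by (auto simp: graph_adjoint_def)
    have adj: "L2_inner M (A w) f = L2_inner M w g" if w: "w \<in> D" for w
    proof -
      have "(w, A w) \<in> graph_closure M ?G"
        using D w op by (subst graph_closure_iff) (auto simp: L2_dist_def intro!: bexI[of _ w])
      then show ?thesis using fg by (auto simp: graph_adjoint_def)
    qed
    have bd: "L2_norm M w \<le> L2_norm M (\<lambda>x. A w x + w x)" if w: "w \<in> D" for w
    proof (cases "L2_norm M w = 0")
      case False
      have "(L2_norm M w)\<^sup>2 \<le> L2_inner M (\<lambda>x. A w x + w x) w"
        using D w nonneg by (simp add: L2_inner_add_left L2_norm_sq nonneg_definite_def)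
      also have "\<dots> \<le> L2_norm M (\<lambda>x. A w x + w x) * L2_norm M w"
        using L2_Cauchy_Schwarz[OF D(3)[OF w] D(1)[OF w]] by simp
      finally show ?thesis
        using False L2_norm_nonneg[of M w] by (simp add: power2_eq_square)
    qed (simp add: L2_norm_nonneg)
    have "\<exists>u\<in>D. L2_dist M f u < e \<and> L2_dist M g (A u) < e" if "0 < e" for e
    proof -
      \<comment> \<open>The distance from f to u will be below 2d, and that from g to A u below d +
        2d.\<close>
      define d where "d = e / 3"
      have "0 < d" using that by (simp add: d_def)
      obtain u where u: "u \<in> D" "L2_dist M (\<lambda>x. f x + g x) (\<lambda>x. A u x + u x) < d"
        using range \<open>0 < d\<close> L2_add[OF fgL] unfolding L2_dense_def by blast
      define k where "k x = f x - u x" for x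
      define r where "r x = (f x + g x) - (A u x + u x)" for x
      have kL: "k \<in> L2 M" unfolding k_def using fgL D u by (intro L2_diff) auto
      have rL: "r \<in> L2 M" unfolding r_def using fgL D u by (intro L2_diff L2_add) auto
      have r: "L2_norm M r < d" using u(2) unfolding L2_dist_norm r_def .
      have main: "\<bar>L2_inner M (\<lambda>x. A w x + w x) k\<bar> \<le> L2_norm M (\<lambda>x. A w x + w x) * L2_norm M r"
        if w: "w \<in> D" for w
      proof -
        have "L2_inner M (A w) u = L2_inner M w (A u)"
          using sym w u by (auto simp: symmetric_operator_def)
        then have "L2_inner M (\<lambda>x. A w x + w x) k = L2_inner M w r"
          unfolding k_def r_def using fgL D w u adj[OF w]
          by (simp add: L2_inner_diff_right L2_inner_add_right L2_inner_add_left L2_add L2_diff)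
        also have "\<bar>\<dots>\<bar> \<le> L2_norm M w * L2_norm M r"
          using D w rL by (intro L2_Cauchy_Schwarz) auto
        also have "\<dots> \<le> L2_norm M (\<lambda>x. A w x + w x) * L2_norm M r"
          using bd[OF w] by (intro mult_right_mono) (auto simp: L2_norm_nonneg)
        finally show ?thesis .
      qed
      \<comment> \<open>If k were itself of the form (A + 1) w, \<open>main\<close> would give K^2
        <= K N for the norms K of k and N of r, that is K <= N < d. As k is only a limit of such
        elements, the bound 2d leaves room for the approximation error.\<close>
      have "L2_norm M k < 2 * d"
      proof (rule ccontr)
        assume "\<not> L2_norm M k < 2 * d"
        then have k: "2 * d \<le> L2_norm M k" by simp
        define K where "K = L2_norm M k"
        define N where "N = L2_norm M r"
        have N: "0 \<le> N" "N < d" using r by (auto simp: N_def L2_norm_nonneg)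
        have K: "2 * d \<le> K" using k by (simp add: K_def)
        \<comment> \<open>Approximating k up to t costs t (K + N) in the estimate; t is chosen so
          that this is half of the gap K (K - N), which is positive because N < d < K.\<close>
        define t where "t = K * (K - N) / (2 * (K + N))"
        have t: "0 < t" using \<open>0 < d\<close> K N by (simp add: t_def)
        obtain w where w: "w \<in> D" "L2_dist M k (\<lambda>x. A w x + w x) < t"
          using range t kL unfolding L2_dense_def by blast
        let ?h = "\<lambda>x. A w x + w x"
        have hn: "L2_norm M ?h \<le> K + t"
          using L2_norm_triangle[OF kL L2_diff[OF D(3)[OF w(1)] kL]] w(2)
          by (simp add: L2_dist_commute[of M k] K_def) (simp add: L2_dist_norm)
        have "K\<^sup>2 = L2_inner M (\<lambda>x. k x - ?h x) k + L2_inner M ?h k"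
          using kL D(3)[OF w(1)] by (simp add: K_def L2_norm_sq L2_inner_diff_left)
        also have "\<dots> \<le> L2_norm M (\<lambda>x. k x - ?h x) * K + L2_norm M ?h * N"
          using L2_Cauchy_Schwarz[OF L2_diff[OF kL D(3)[OF w(1)]] kL] main[OF w(1)]
          by (simp add: K_def N_def)
        also have "\<dots> \<le> t * K + (K + t) * N"
          using w(2) hn N K \<open>0 < d\<close> by (intro add_mono mult_right_mono) (auto simp: L2_dist_norm)
        also have "\<dots> = K * N + t * (K + N)" by (simp add: algebra_simps)
        also have "\<dots> = K * N + K * (K - N) / 2"
        proof -
          have "K + N \<noteq> 0" using N K \<open>0 < d\<close> by simp
          then have "t * (K + N) = K * (K - N) / 2" unfolding t_def by (simp add: divide_simps)
          then show ?thesis by simp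
        qed
        finally have "K * K - K * N \<le> (K * K - K * N) / 2"
          unfolding power2_eq_square right_diff_distrib by linarith
        moreover have "z \<le> 0" if "z \<le> z / 2" for z :: real using that by linarith
        ultimately have "K * K - K * N \<le> 0" by blast
        then have "K * (K - N) \<le> 0" by (simp add: right_diff_distrib)
        moreover have "0 < K * (K - N)" using N K \<open>0 < d\<close> by simp
        ultimately show False by simp
      qed
      then have 1: "L2_dist M f u < 2 * d" unfolding L2_dist_norm k_def .
      \<comment> \<open>From the definitions of r and k, g - A u = r - k.\<close>
      have "L2_dist M g (A u) = L2_norm M (\<lambda>x. r x + (-1) * k x)"
        by (simp add: L2_dist_norm r_def k_def)
      also have "\<dots> \<le> L2_norm M r + L2_norm M k"
        using L2_norm_triangle[OF rL L2_scale[OF kL, of "-1"]] L2_norm_scale[of M "-1" k] by simp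
      also have "\<dots> < 3 * d" using r \<open>L2_norm M k < 2 * d\<close> by simp
      finally have 2: "L2_dist M g (A u) < e" by (simp add: d_def)
      have "L2_dist M f u < e" using 1 \<open>0 < d\<close> by (simp add: d_def)
      with 2 u show ?thesis by blast
    qed
    then show "(f, g) \<in> graph_closure M ?G"
      using fgL op by (subst graph_closure_iff) auto
  qed
  then show ?thesis
    using assms by (simp add: essentially_self_adjoint_def)
qed

section \<open>Test functions: locally constant with compact support\<close>

lemma nontrivial_ball: "T \<in> nontrivial_balls \<Longrightarrow> T \<in> all_balls"
  by (simp add: nontrivial_balls_def)

lemma locally_constant_indicator:
  assumes "open V" "closed V"
  shows "locally_constant (indicator V :: 'a::topological_space \<Rightarrow> real)"
  unfolding locally_constant_def
proof
  fix x :: 'a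
  show "\<exists>U. open U \<and> x \<in> U \<and> (indicator V :: 'a \<Rightarrow> real) constant_on U"
  proof (cases "x \<in> V")
    case True
    then show ?thesis using assms by (intro exI[of _ V]) (auto simp: constant_on_def)
  next
    case False
    then show ?thesis using assms by (intro exI[of _ "- V"]) (auto simp: constant_on_def indicator_def)
  qed
qed

lemma indicator_test_function:
  assumes "open V" "compact V"
  shows "(indicator V :: 'a::metric_space \<Rightarrow> real) \<in> test_functions"
proof -
  have V: "closed V" using assms by (simp add: compact_imp_closed)
  have "{x. indicator V x \<noteq> (0::real)} = V" by (auto simp: indicator_def)
  then show ?thesis
    using locally_constant_indicator[OF assms(1) V] assms V by (simp add: test_functions_def)
qed

lemma function_subspace_test_functions: "function_subspace (test_functions :: ('a::metric_space \<Rightarrow> real) set)"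
  unfolding function_subspace_def
proof (intro conjI ballI allI)
  show "(\<lambda>_. 0) \<in> (test_functions :: ('a \<Rightarrow> real) set)"
    by (auto simp: test_functions_def locally_constant_def constant_on_def)
next
  fix f g :: "'a \<Rightarrow> real" and a b :: real
  assume f: "f \<in> test_functions" and g: "g \<in> test_functions"
  have "locally_constant (\<lambda>x. a * f x + b * g x)"
    unfolding locally_constant_def
  proof
    fix x
    obtain U V where U: "open U" "x \<in> U" "f constant_on U" and V: "open V" "x \<in> V" "g constant_on V"
      using f g unfolding test_functions_def locally_constant_def by blast
    have "(\<lambda>x. a * f x + b * g x) constant_on (U \<inter> V)"
      using U V by (auto simp: constant_on_def)
    then show "\<exists>U. open U \<and> x \<in> U \<and> (\<lambda>x. a * f x + b * g x) constant_on U"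
      using U V by (intro exI[of _ "U \<inter> V"]) auto
  qed
  moreover have "compact (closure {x. a * f x + b * g x \<noteq> 0})"
  proof -
    let ?K = "closure {x. f x \<noteq> 0} \<union> closure {x. g x \<noteq> 0}"
    have K: "compact ?K" using f g by (auto simp: test_functions_def)
    have "{x. a * f x + b * g x \<noteq> 0} \<subseteq> {x. f x \<noteq> 0} \<union> {x. g x \<noteq> 0}" by auto
    then have "closure {x. a * f x + b * g x \<noteq> 0} \<subseteq> ?K"
      unfolding closure_Un[symmetric] by (rule closure_mono)
    then show ?thesis
      using compact_Int_closed[OF K closed_closure, of "{x. a * f x + b * g x \<noteq> 0}"]
      by (simp only: Int_absorb1)
  qed
  ultimately show "(\<lambda>x. a * f x + b * g x) \<in> test_functions" by (simp add: test_functions_def)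
qed

section \<open>Proper ultrametric spaces\<close>

locale proper_ultrametric_space =
  fixes X :: "'a::metric_space itself"
  assumes ultra: "ultrametric X"
    and proper: "proper_metric X"
begin

lemma dist_ultra: "dist x z \<le> max (dist x y) (dist y (z::'a))"
  using ultra by (auto simp: ultrametric_def)

text \<open>The ultrametric inequality, once in each direction. Nestedness of meeting balls,
  closedness of balls and the finiteness results below all rest on this change of centre.\<close>

lemma ball_recentre:
  assumes "y \<in> ball x r" shows "ball y r = ball (x::'a) r"
proof (intro set_eqI iffI)
  fix z assume "z \<in> ball y r"
  then show "z \<in> ball x r" using assms dist_ultra[of x z y] by auto
next
  fix z assume "z \<in> ball x r"
  then show "z \<in> ball y r" using assms dist_ultra[of y z x] by (auto simp: dist_commute)
qed

lemma all_balls_centre: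
  assumes "B \<in> all_balls" "x \<in> B"
  obtains r where "0 < r" "B = ball (x::'a) r"
  using assms ball_recentre unfolding all_balls_def by fastforce

lemma ball_in_all_balls: "0 < r \<Longrightarrow> ball (x::'a) r \<in> all_balls"
  by (auto simp: all_balls_def)

lemma all_balls_nonempty: "B \<in> all_balls \<Longrightarrow> B \<noteq> ({}::'a set)"
  by (auto simp: all_balls_def)

lemma all_balls_nested:
  assumes "B \<in> all_balls" "T \<in> all_balls" "x \<in> B" "(x::'a) \<in> T"
  shows "B \<subseteq> T \<or> T \<subseteq> B"
proof -
  obtain r s where "B = ball x r" "T = ball x s"
    using assms by (metis all_balls_centre)
  then show ?thesis by (cases "r \<le> s") (auto intro: subset_ball)
qed

lemma all_balls_open: "B \<in> all_balls \<Longrightarrow> open (B::'a set)"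
  by (auto simp: all_balls_def)

text \<open>A point outside B has a ball of the same radius around it that misses B: a common point
  would be a centre of both, making them equal.\<close>

lemma all_balls_closed:
  assumes "B \<in> all_balls" shows "closed (B::'a set)"
proof -
  obtain a r where B: "B = ball a r" "0 < r" using assms by (auto simp: all_balls_def)
  have "\<exists>e>0. ball y e \<subseteq> - B" if "y \<in> - B" for y
  proof (intro exI[of _ r] conjI subsetI)
    fix z assume z: "z \<in> ball y r"
    show "z \<in> - B"
    proof
      assume "z \<in> B"
      then have "ball z r = B" "ball z r = ball y r"
        using ball_recentre[of z a r] ball_recentre[of z y r] z B(1) by blast+
      moreover have "y \<in> ball y r" using B(2) by simp
      ultimately show False using that by auto
    qed
  qed (use B in auto)
  then have "open (- B)" by (simp add: open_contains_ball)
  then show ?thesis by (simp add: closed_def)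
qed

lemma all_balls_compact:
  assumes "B \<in> all_balls" shows "compact (B::'a set)"
proof -
  obtain a r where B: "B = ball a r" "0 < r" using assms by (auto simp: all_balls_def)
  have "compact (cball a r \<inter> B)"
    using proper all_balls_closed[OF assms] by (intro compact_Int_closed) (auto simp: proper_metric_def)
  moreover have "cball a r \<inter> B = B" using B by auto
  ultimately show ?thesis by simp
qed

text \<open>Balls of equal radius are equal or disjoint, so a finite subcover of K by such balls
  already contains every one of them that is centred in K.\<close>

lemma finite_balls_cover:
  assumes "compact (K::'a set)" "0 < r"
  shows "finite ((\<lambda>x. ball x r) ` K)"
proof -
  obtain F where F: "F \<subseteq> K" "finite F" "K \<subseteq> (\<Union>x\<in>F. ball x r)"
  proof (rule compactE_image[OF assms(1), of K "\<lambda>x. ball x r"])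
    show "K \<subseteq> (\<Union>x\<in>K. ball x r)" using assms(2) by auto
  qed auto
  have "(\<lambda>x. ball x r) ` K \<subseteq> (\<lambda>x. ball x r) ` F"
  proof clarify
    fix y assume "y \<in> K"
    then obtain x where "x \<in> F" "y \<in> ball x r" using F by auto
    then show "ball y r \<in> (\<lambda>x. ball x r) ` F" using ball_recentre by auto
  qed
  then show ?thesis using F finite_surj by blast
qed

text \<open>The radius r of B is a mesh size: a ball S containing B is a union of balls of radius r,
  and only finitely many of these are centred in the compact set T. Hence S is determined by a
  subset of a finite set.\<close>

lemma finite_balls_between:
  assumes "B \<in> all_balls" "T \<in> all_balls"
  shows "finite {S \<in> all_balls. B \<subseteq> S \<and> S \<subseteq> (T::'a set)}"
proof -
  obtain a r where B: "B = ball a r" "0 < r" using assms by (auto simp: all_balls_def)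
  let ?P = "(\<lambda>x. ball x r) ` T"
  have "S = \<Union>{b \<in> ?P. b \<subseteq> S}" if S: "S \<in> all_balls" "B \<subseteq> S" "S \<subseteq> T" for S
  proof
    have "a \<in> S" using S B by auto
    then obtain s where s: "S = ball a s" "0 < s" using S by (metis all_balls_centre)
    show "S \<subseteq> \<Union>{b \<in> ?P. b \<subseteq> S}"
    proof
      fix y assume y: "y \<in> S"
      have "ball y r \<subseteq> S"
      proof (cases "r \<le> s")
        case True
        then show ?thesis using ball_recentre[of y a s] y s subset_ball[of r s y] by auto
      next
        \<comment> \<open>A radius s below r about the centre of B gives a set inside B, hence S =
          B, which is itself a single ball of radius r.\<close>
        case False
        then have "S = B" using s B S subset_ball[of s r a] by auto
        then show ?thesis using ball_recentre[of y a r] y B by auto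
      qed
      then show "y \<in> \<Union>{b \<in> ?P. b \<subseteq> S}" using y S B by (auto intro!: exI[of _ "ball y r"])
    qed
  qed auto
  then have "{S \<in> all_balls. B \<subseteq> S \<and> S \<subseteq> T} \<subseteq> Union ` Pow ?P" by blast
  moreover have "finite ?P" by (rule finite_balls_cover[OF all_balls_compact[OF assms(2)] B(2)])
  ultimately show ?thesis by (meson finite_Pow_iff finite_imageI finite_subset)
qed

lemma exhausting_balls:
  assumes "B \<in> all_balls"
  shows "\<forall>\<^sub>F n in sequentially. B \<subseteq> ball (x::'a) (real (Suc n))"
proof -
  have "bounded B" using all_balls_compact[OF assms] by (rule compact_imp_bounded)
  then obtain e where e: "\<And>y. y \<in> B \<Longrightarrow> dist x y \<le> e" by (auto simp: bounded_any_center[where a = x])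
  obtain N where "e < real N" using reals_Archimedean2 by blast
  then have "B \<subseteq> ball x (real (Suc n))" if "N \<le> n" for n
    using e that by fastforce
  then show ?thesis by (auto simp: eventually_sequentially)
qed

text \<open>The finitely many balls between B and T that are larger than B have a minimal element;
  since balls containing B are nested, minimal means least, also in comparison with balls not inside
  T.\<close>

lemma exists_immediate_predecessor:
  assumes B: "B \<in> all_balls" and T: "T \<in> all_balls" and BT: "B \<subset> (T::'a set)"
  obtains B' where "immediate_predecessor B' B" "B' \<subseteq> T"
proof -
  let ?S = "{S \<in> all_balls. B \<subset> S \<and> S \<subseteq> T}"
  have fin: "finite ?S"
    by (rule finite_subset[OF _ finite_balls_between[OF B T]]) auto
  have ne: "?S \<noteq> {}" using T BT by auto
  obtain B' where "B' \<in> ?S" "\<forall>S\<in>?S. S \<subseteq> B' \<longrightarrow> B' = S"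
    using finite_has_minimal[OF fin ne] ..
  then have B': "B' \<in> ?S" "\<And>S. S \<in> ?S \<Longrightarrow> S \<subseteq> B' \<Longrightarrow> S = B'" by blast+
  obtain x where x: "x \<in> B" using all_balls_nonempty[OF B] by auto
  have "B' \<subseteq> S" if S: "S \<in> all_balls" "B \<subset> S" for S
  proof -
    have "S \<subseteq> B' \<or> B' \<subseteq> S" using all_balls_nested[of S B' x] S B' x by auto
    then show ?thesis
    proof
      assume "S \<subseteq> B'"
      then show ?thesis using B'(2)[of S] S B'(1) by auto
    qed
  qed
  then have "immediate_predecessor B' B" "B' \<subseteq> T"
    using B B' by (auto simp: immediate_predecessor_def)
  then show thesis by (rule that)
qed

lemma nontrivial_of_psubset:
  assumes "B \<in> all_balls" "T \<in> all_balls" "B \<subset> (T::'a set)"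
  shows "T \<in> nontrivial_balls"
  using assms all_balls_nonempty[OF assms(1)]
  by (auto simp: nontrivial_balls_def is_singleton_def)

lemma ball_indicator_test_function:
  "B \<in> all_balls \<Longrightarrow> (indicator B :: 'a \<Rightarrow> real) \<in> test_functions"
  by (rule indicator_test_function[OF all_balls_open all_balls_compact])

text \<open>A Lebesgue number e for the cover of the support by open sets of constancy makes f
  constant on each ball of radius e centred in the support. These balls are finitely many and
  disjoint, so f is a finite combination of their indicators.\<close>

lemma test_functions_induct [consumes 1, case_names zero add]:
  assumes f: "f \<in> (test_functions :: ('a \<Rightarrow> real) set)"
    and zero: "P (\<lambda>_. 0)"
    and add: "\<And>a B g. B \<in> all_balls \<Longrightarrow> g \<in> test_functions \<Longrightarrow> P g \<Longrightarrow>
      P (\<lambda>x. a * indicator B x + g x)"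
  shows "P f"
proof -
  define K where "K = closure {x. f x \<noteq> 0}"
  have K: "compact K" and lc: "locally_constant f" using f by (auto simp: test_functions_def K_def)
  have fK: "f x = 0" if "x \<notin> K" for x
    using that closure_subset[of "{x. f x \<noteq> 0}"] by (auto simp: K_def)
  obtain e where e: "0 < e" "\<And>x. x \<in> K \<Longrightarrow> \<exists>G\<in>{U. open U \<and> f constant_on U}. ball x e \<subseteq> G"
  proof (rule Heine_Borel_lemma[OF K, of "{U. open U \<and> f constant_on U}"])
    show "K \<subseteq> \<Union>{U. open U \<and> f constant_on U}"
      using lc unfolding locally_constant_def by blast
  qed auto
  have const: "f y = f z" if x: "x \<in> K" "y \<in> ball x e" "z \<in> ball x e" for x y z
  proof -
    obtain G c where "ball x e \<subseteq> G" "\<And>w. w \<in> G \<Longrightarrow> f w = c"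
      using e(2)[OF x(1)] unfolding constant_on_def by blast
    with x(2,3) show ?thesis by (metis subsetD)
  qed
  define F where "F = (\<lambda>x. ball x e) ` K"
  have F: "finite F" unfolding F_def by (rule finite_balls_cover[OF K e(1)])
  have Fb: "F \<subseteq> all_balls" using e(1) ball_in_all_balls by (auto simp: F_def)
  \<comment> \<open>The value at an arbitrary point of the ball; \<open>const\<close> makes the
    choice immaterial.\<close>
  define v where "v B = f (SOME c. c \<in> B)" for B
  have val: "v B = f x" if B: "B \<in> F" "x \<in> B" for x B
  proof -
    have "(SOME c. c \<in> B) \<in> B" using B(2) by (rule someI)
    moreover obtain k where "k \<in> K" "B = ball k e" using B(1) by (auto simp: F_def)
    ultimately show ?thesis using B(2) const[of k] unfolding v_def by blast
  qed
  have "(\<lambda>x. \<Sum>B\<in>G. v B * indicator B x) \<in> test_functions \<and> P (\<lambda>x. \<Sum>B\<in>G. v B * indicator B x)"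
    if "G \<subseteq> F" for G
    using finite_subset[OF that F] that
  proof (induction G rule: finite_induct)
    case empty
    then show ?case using zero function_subspace_zero[OF function_subspace_test_functions] by simp
  next
    case (insert B G)
    then have "(\<lambda>x. \<Sum>B\<in>G. v B * indicator B x) \<in> test_functions \<and>
        P (\<lambda>x. \<Sum>B\<in>G. v B * indicator B x)"
      and B: "B \<in> all_balls" using Fb by blast+
    then have IH: "(\<lambda>x. \<Sum>B\<in>G. v B * indicator B x) \<in> test_functions"
      "P (\<lambda>x. \<Sum>B\<in>G. v B * indicator B x)" by blast+
    show ?case
      unfolding sum.insert[OF insert.hyps]
      using add[OF B IH, of "v B"]
        function_subspace_add_scale[OF function_subspace_test_functions
          ball_indicator_test_function[OF B] IH(1), of "v B" 1]
      by (simp only: mult_1)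
  qed
  moreover have "(\<lambda>x. \<Sum>B\<in>F. v B * indicator B x) = f"
  proof
    fix x
    show "(\<Sum>B\<in>F. v B * indicator B x) = f x"
    proof (cases "\<exists>B\<in>F. x \<in> B")
      case True
      then obtain B where B: "B \<in> F" "x \<in> B" by auto
      \<comment> \<open>Every ball of \<open>F\<close> that contains x is the ball of radius e about
        x, so at most one term of the sum is nonzero at x.\<close>
      have centre: "B' = ball x e" if "B' \<in> F" "x \<in> B'" for B'
      proof -
        obtain k where "B' = ball k e" using \<open>B' \<in> F\<close> unfolding F_def by blast
        with \<open>x \<in> B'\<close> show ?thesis using ball_recentre[of x k e] by simp
      qed
      have "B' = B" if "B' \<in> F" "x \<in> B'" for B'
        using centre[OF that] centre[OF B] by simp
      then have "\<forall>B'\<in>F - {B}. v B' * indicator B' x = 0" by (auto simp: indicator_def)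
      then have "(\<Sum>B\<in>F. v B * indicator B x) = (\<Sum>B\<in>{B}. v B * indicator B x)"
        by (intro sum.mono_neutral_right) (use F B in auto)
      also have "\<dots> = v B" using B(2) by simp
      also have "\<dots> = f x" by (rule val[OF B])
      finally show ?thesis .
    next
      case False
      then have "x \<notin> K" using e(1) by (auto simp: F_def)
      then show ?thesis using False fK by (auto intro!: sum.neutral simp: indicator_def)
    qed
  qed
  ultimately show ?thesis by auto
qed

end

section \<open>Density of the test functions\<close>

locale hierarchical_space = proper_ultrametric_space "TYPE('a::metric_space)" +
  fixes M :: "'a::metric_space measure" and C :: "'a set \<Rightarrow> real"
  assumes radon: "radon_measure M"
    and ball_pos: "\<And>B. B \<in> all_balls \<Longrightarrow> 0 < diameter B \<Longrightarrow> 0 < emeasure M B"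
    and atoms: "\<And>x. emeasure M {x} = 0 \<longleftrightarrow> \<not> x isolated_in UNIV"
    and choice: "choice_function C"
begin

lemma sets_M: "sets M = sets borel"
  using radon by (simp add: radon_measure_def)

lemma space_M: "space M = UNIV"
  using sets_eq_imp_space_eq[OF sets_M] by simp

lemma ball_sets: "B \<in> all_balls \<Longrightarrow> B \<in> sets M"
  using all_balls_open by (auto simp: sets_M)

lemma emeasure_compact_finite: "compact K \<Longrightarrow> emeasure M K < \<infinity>"
  using radon by (simp add: radon_measure_def)

lemma ball_finite: "B \<in> all_balls \<Longrightarrow> emeasure M B < \<infinity>"
  using emeasure_compact_finite all_balls_compact by blast

lemma emeasure_ball: "B \<in> all_balls \<Longrightarrow> emeasure M B = ennreal (measure M B)"
  using ball_finite by (simp add: emeasure_eq_ennreal_measure less_top)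

text \<open>The hypothesis on balls concerns positive diameter; a one-point ball is covered by the
  condition on atoms, its point being isolated because balls are open.\<close>

lemma ball_measure_pos:
  assumes B: "B \<in> all_balls" shows "0 < measure M B"
proof -
  obtain a where a: "a \<in> B" using all_balls_nonempty[OF B] by auto
  have "0 < emeasure M B"
  proof (cases "B = {a}")
    case True
    then have "a isolated_in UNIV"
      using all_balls_open[OF B] by (auto simp: isolated_in_def)
    then show ?thesis using atoms[of a] True by (simp add: zero_less_iff_neq_zero)
  next
    case False
    then obtain b where b: "b \<in> B" "b \<noteq> a" using a by auto
    have "bounded B" using all_balls_compact[OF B] by (rule compact_imp_bounded)
    then have "dist a b \<le> diameter B" using a b by (simp add: diameter_bounded_bound)
    then have "0 < diameter B" using b by (smt (verit) zero_less_dist_iff)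
    then show ?thesis using ball_pos[OF B] by simp
  qed
  then show ?thesis by (simp add: emeasure_ball[OF B])
qed

lemma measure_ball_mono:
  assumes "B \<in> all_balls" "T \<in> all_balls" "B \<subseteq> T"
  shows "measure M B \<le> measure M T"
  using assms ball_sets ball_finite by (intro measure_mono_fmeasurable) (auto simp: fmeasurable_def)

lemma ball_indicator_L2: "B \<in> all_balls \<Longrightarrow> indicator B \<in> L2 M"
  using ball_sets ball_finite by (intro L2_indicator)

lemma integrable_ball_indicator: "B \<in> all_balls \<Longrightarrow> integrable M (indicator B :: 'a \<Rightarrow> real)"
  using ball_sets ball_finite by (simp add: integrable_indicator_iff)

lemma test_functions_L2: "test_functions \<subseteq> L2 M"
proof
  fix f :: "'a \<Rightarrow> real" assume "f \<in> test_functions"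
  then show "f \<in> L2 M"
  proof (induction rule: test_functions_induct)
    case (add a B g)
    then show ?case using L2_lincomb[OF ball_indicator_L2, of B g a 1] by simp
  qed (rule L2_zero)
qed

lemma test_functions_integrable:
  assumes "f \<in> test_functions" shows "integrable M f"
  using assms
proof (induction rule: test_functions_induct)
  case (add a B g)
  then show ?case using integrable_ball_indicator[of B] by simp
qed simp

text \<open>For A of finite measure, regularity gives an open U around A and a compact K inside U,
  both close in measure. The balls of a small fixed radius about K are finitely many, so their union
  V is open and compact, and it lies between K and U.\<close>

lemma test_functions_dense: "L2_dense M test_functions"
proof (rule L2_dense_if_indicators[OF test_functions_L2 function_subspace_test_functions])
  fix A assume A: "A \<in> sets M" "emeasure M A < \<infinity>"
  show "indicator A \<in> L2_closure M test_functions"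
    unfolding L2_closure_def
  proof (intro CollectI conjI allI impI L2_indicator A)
    fix e :: real assume "0 < e"
    \<comment> \<open>The squared distance of two indicators is the measure of the symmetric
      difference, to which outer and inner regularity contribute at most d each.\<close>
    define d where "d = e\<^sup>2 / 2"
    have d: "0 < d" using \<open>0 < e\<close> by (simp add: d_def)
    have "emeasure M A < emeasure M A + ennreal d"
      using A d by (simp add: less_top ennreal_add_left_cancel_less)
    moreover have "emeasure M A = (INF U\<in>{U. open U \<and> A \<subseteq> U}. emeasure M U)"
      using radon A by (auto simp: radon_measure_def)
    ultimately obtain U where U: "open U" "A \<subseteq> U" "emeasure M U < emeasure M A + ennreal d"
      by (auto simp: INF_less_iff)
    have Ufin: "emeasure M U < \<infinity>" using U A by (simp add: less_top) (metis ennreal_add_eq_top ennreal_neq_top less_top order_less_trans)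
    have Us: "U \<in> sets M" using U by (simp add: sets_M)
    \<comment> \<open>If m(U) <= d, the empty set serves; otherwise m(U) - d is strictly below the
      supremum m(U), and inner regularity applies.\<close>
    obtain K where K: "compact K" "K \<subseteq> U" "emeasure M U \<le> emeasure M K + ennreal d"
    proof (cases "emeasure M U \<le> ennreal d")
      case True
      then show thesis using that[of "{}"] by simp
    next
      case False
      then have "emeasure M U - ennreal d < emeasure M U"
        using Ufin d by (cases "emeasure M U") (auto simp: ennreal_minus ennreal_less_iff)
      moreover have "emeasure M U = (SUP K\<in>{K. compact K \<and> K \<subseteq> U}. emeasure M K)"
        using radon U by (auto simp: radon_measure_def)
      ultimately obtain K where K: "compact K" "K \<subseteq> U" "emeasure M U - ennreal d < emeasure M K"
        by (auto simp: less_SUP_iff)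
      have "emeasure M U \<le> emeasure M K + ennreal d"
        using less_imp_le[OF K(3)] by (simp add: ennreal_minus_le_iff add.commute)
      with K show thesis by (intro that)
    qed
    obtain r where r: "0 < r" "\<And>x. x \<in> K \<Longrightarrow> ball x r \<subseteq> U"
      using Heine_Borel_lemma[OF K(1), of "{U}"] K(2) U(1) by auto
    define V where "V = (\<Union>x\<in>K. ball x r)"
    have V: "open V" "K \<subseteq> V" "V \<subseteq> U" using r by (auto simp: V_def)
    have Vc: "compact V"
    proof -
      have "compact (\<Union>((\<lambda>x. ball x r) ` K))"
        using r(1) by (intro compact_Union finite_balls_cover K(1)) (auto intro: all_balls_compact ball_in_all_balls)
      then show ?thesis by (simp add: V_def)
    qed
    have Vs: "V \<in> sets M" "K \<in> sets M"
      using V(1) compact_imp_closed[OF K(1)] by (auto simp: sets_M)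
    have fm: "A \<in> fmeasurable M" "U \<in> fmeasurable M" "V \<in> fmeasurable M" "K \<in> fmeasurable M"
      using A Us Ufin Vs emeasure_compact_finite[OF Vc] emeasure_compact_finite[OF K(1)]
      by (auto simp: fmeasurable_def)
    have 1: "measure M U < measure M A + d"
      using U(3) fm d by (simp add: emeasure_eq_measure2 ennreal_less_iff flip: ennreal_plus)
    have 2: "measure M U \<le> measure M V + d"
    proof -
      have "measure M U \<le> measure M K + d"
        using K(3) fm d by (simp add: emeasure_eq_measure2 flip: ennreal_plus)
      also have "measure M K \<le> measure M V" using V fm Vs by (intro measure_mono_fmeasurable) auto
      finally show ?thesis by simp
    qed
    \<comment> \<open>A and V both lie in U, so where they differ one of them fails to fill
      U.\<close>
    have "measure M ((A - V) \<union> (V - A)) \<le> measure M ((U - V) \<union> (U - A))"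
      using U V fm A Vs by (intro measure_mono_fmeasurable) (auto intro!: fmeasurable.Un fmeasurable.Diff)
    also have "\<dots> \<le> measure M (U - V) + measure M (U - A)"
      using fm A Us Vs by (intro measure_Un_le) auto
    also have "\<dots> = (measure M U - measure M V) + (measure M U - measure M A)"
      using fm A Us Vs U V by (simp add: measurable_measure_Diff)
    also have "\<dots> < e\<^sup>2" using 1 2 by (simp add: d_def)
    finally have "L2_dist M (indicator A) (indicator V) < sqrt (e\<^sup>2)"
      by (simp add: L2_dist_indicator A Vs del: real_sqrt_abs)
    then show "\<exists>h\<in>test_functions. L2_dist M (indicator A) h < e"
      using indicator_test_function[OF V(1) Vc] \<open>0 < e\<close> by auto
  qed
qed

section \<open>The hierarchical Laplacian\<close>

text \<open>The inclusion is strict, unlike in \<open>hlambda\<close>: on B itself, 1_B minus its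
  average vanishes, so T = B contributes nothing to L 1_B.\<close>

definition chain :: "'a set \<Rightarrow> 'a set set" where
  "chain B = {T \<in> nontrivial_balls. B \<subset> T}"

text \<open>Finite truncations of \<open>chain B\<close>. \<open>Suc n\<close> makes the bounding
  ball nonempty for n = 0 as well.\<close>

definition chain_upto :: "'a \<Rightarrow> 'a set \<Rightarrow> nat \<Rightarrow> 'a set set" where
  "chain_upto x B n = {T \<in> chain B. T \<subseteq> ball x (real (Suc n))}"

text \<open>For a nontrivial ball B this is \<open>hlambda C B - C B\<close>. The strict version
  tends to 0 as B grows to X in every case: if X is itself a nontrivial ball,
  \<open>chain_sum\<close> is 0 there, whereas \<open>hlambda C\<close> takes the value of
  \<open>C\<close> at X.\<close>

definition chain_sum :: "'a set \<Rightarrow> real" where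
  "chain_sum B = infsum C (chain B)"

text \<open>For B inside T this is 1_B - P_T 1_B on T and 0 off T. The extension by zero lets the
  series for L 1_B run over \<open>chain B\<close> at every point, instead of over the balls
  containing the point.\<close>

definition centred_indicator :: "'a set \<Rightarrow> 'a set \<Rightarrow> 'a \<Rightarrow> real" where
  "centred_indicator B T y = indicator B y - measure M B / measure M T * indicator T y"

lemma chain_ball: "T \<in> chain B \<Longrightarrow> T \<in> all_balls"
  by (simp add: chain_def nontrivial_balls_def)

lemma C_pos: "T \<in> nontrivial_balls \<Longrightarrow> 0 < C T"
  using choice by (simp add: choice_function_def)

lemma C_chain_pos: "T \<in> chain B \<Longrightarrow> 0 < C T"
  by (simp add: chain_def C_pos)

lemma C_summable_chain:
  assumes "B \<in> all_balls" shows "C summable_on chain B"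
proof -
  have "C summable_on {T \<in> nontrivial_balls. B \<subseteq> T}"
    using choice assms by (simp add: choice_function_def)
  then show ?thesis
    by (rule summable_on_subset_banach) (auto simp: chain_def)
qed

lemma C_bounded_summable:
  assumes B: "B \<in> all_balls" and bd: "\<And>T. T \<in> chain B \<Longrightarrow> \<bar>w T\<bar> \<le> K"
  shows "(\<lambda>T. C T * w T) summable_on chain B"
proof -
  have "(\<lambda>T. C T * K) summable_on chain B"
    by (rule summable_on_cmult_left[OF C_summable_chain[OF B]])
  then have "(\<lambda>T. norm (C T * w T)) summable_on chain B"
  proof (rule Infinite_Sum.abs_summable_on_comparison_test')
    fix T assume T: "T \<in> chain B"
    show "norm (C T * w T) \<le> C T * K"
      using bd[OF T] C_chain_pos[OF T] by (simp add: abs_mult)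
  qed
  then show ?thesis by (rule Infinite_Sum.abs_summable_summable)
qed

lemma finite_chain_upto:
  assumes "B \<in> all_balls" shows "finite (chain_upto x B n)"
  by (rule finite_subset[OF _ finite_balls_between[OF assms, of "ball x (real (Suc n))"]])
    (auto simp: chain_upto_def chain_def nontrivial_balls_def intro: ball_in_all_balls)

text \<open>Fatou's lemma and dominated convergence are about sequences; this turns an unordered sum
  over \<open>chain B\<close> into a limit of truncations, since finitely many balls eventually lie
  inside the bounding ball.\<close>

lemma filterlim_chain_upto:
  assumes B: "B \<in> all_balls"
  shows "filterlim (chain_upto x B) (finite_subsets_at_top (chain B)) sequentially"
  unfolding filterlim_finite_subsets_at_top
proof (intro allI impI)
  fix X assume X: "finite X \<and> X \<subseteq> chain B"
  then have "\<forall>T\<in>X. \<forall>\<^sub>F n in sequentially. T \<subseteq> ball x (real (Suc n))"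
    using exhausting_balls chain_ball by blast
  then have "\<forall>\<^sub>F n in sequentially. \<forall>T\<in>X. T \<subseteq> ball x (real (Suc n))"
    using X by (intro eventually_ball_finite) auto
  then show "\<forall>\<^sub>F n in sequentially. finite (chain_upto x B n) \<and> X \<subseteq> chain_upto x B n \<and>
      chain_upto x B n \<subseteq> chain B"
  proof eventually_elim
    case (elim n)
    then show ?case using X finite_chain_upto[OF B] by (auto simp: chain_upto_def)
  qed
qed

lemma has_sum_chain_LIMSEQ:
  assumes "B \<in> all_balls" "(f has_sum s) (chain B)"
  shows "(\<lambda>n. sum f (chain_upto x B n)) \<longlonglongrightarrow> s"
  using filterlim_compose[OF assms(2)[unfolded has_sum_def] filterlim_chain_upto[OF assms(1)]] .

lemma chain_sum_nonneg: "0 \<le> chain_sum B"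
  unfolding chain_sum_def by (intro infsum_nonneg less_imp_le C_chain_pos)

lemma sum_C_le_chain_sum:
  assumes "B \<in> all_balls"
  shows "sum C (chain_upto x B n) \<le> chain_sum B"
  unfolding chain_sum_def
proof (rule finite_sum_le_infsum[OF C_summable_chain[OF assms] finite_chain_upto[OF assms]])
  show "chain_upto x B n \<subseteq> chain B" by (auto simp: chain_upto_def)
  show "0 \<le> C T" if "T \<in> chain B - chain_upto x B n" for T
    using that C_chain_pos[of T B] by simp
qed

lemma chain_measures:
  assumes "B \<in> all_balls" "T \<in> chain B"
  shows "0 < measure M B" "measure M B \<le> measure M T" "0 < measure M T"
proof -
  have T: "T \<in> all_balls" "B \<subseteq> T" using assms(2) chain_ball by (auto simp: chain_def)
  show "0 < measure M B" "0 < measure M T"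
    by (rule ball_measure_pos[OF assms(1)], rule ball_measure_pos[OF T(1)])
  show "measure M B \<le> measure M T"
    by (rule measure_ball_mono[OF assms(1) T])
qed

lemma centred_indicator_bound:
  assumes "B \<in> all_balls" "T \<in> chain B"
  shows "\<bar>centred_indicator B T y\<bar> \<le> 1"
proof -
  have "0 \<le> measure M B / measure M T" "measure M B / measure M T \<le> 1"
    using chain_measures[OF assms] by auto
  then show ?thesis
    using assms(2) by (auto simp: centred_indicator_def chain_def indicator_def)
qed

lemma centred_indicator_summable:
  assumes "B \<in> all_balls"
  shows "(\<lambda>T. C T * centred_indicator B T x) summable_on chain B"
  by (rule C_bounded_summable[OF assms centred_indicator_bound[OF assms]])

lemma set_integral_indicator_ball:
  assumes "B \<in> all_balls" "T \<in> all_balls"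
  shows "(LINT x:T|M. indicator B x) = measure M (T \<inter> B)"
proof -
  have "(LINT x:T|M. indicator B x :: real) = (LINT x|M. indicator (T \<inter> B) x)"
    unfolding set_lebesgue_integral_def by (simp add: indicator_inter_arith)
  also have "\<dots> = measure M (T \<inter> B)" by (simp add: space_M)
  finally show ?thesis .
qed

text \<open>A ball T around x that does not strictly contain B lies inside B or misses it, and in
  both cases 1_B is constant on T. A ball of \<open>chain B\<close> that misses x gives a zero of
  \<open>centred_indicator\<close>. The remaining terms agree up to the sign.\<close>

lemma laplacian_terms_indicator:
  assumes B: "B \<in> all_balls"
  shows "((\<lambda>T. C T * (ball_average M T (indicator B) - indicator B x)) has_sum
    - (\<Sum>\<^sub>\<infinity>T\<in>chain B. C T * centred_indicator B T x)) {T \<in> nontrivial_balls. x \<in> T}"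
proof -
  have "((\<lambda>T. - (C T * centred_indicator B T x)) has_sum
      - (\<Sum>\<^sub>\<infinity>T\<in>chain B. C T * centred_indicator B T x)) (chain B)"
    using has_sum_infsum[OF centred_indicator_summable[OF B]] by (simp add: has_sum_uminus)
  also have "?this \<longleftrightarrow> ?thesis"
  proof (rule has_sum_cong_neutral)
    fix T assume "T \<in> {T \<in> nontrivial_balls. x \<in> T} - chain B"
    then have T: "T \<in> nontrivial_balls" "x \<in> T" "\<not> B \<subset> T" by (auto simp: chain_def)
    then have Tb: "T \<in> all_balls" by (simp add: nontrivial_ball)
    show "C T * (ball_average M T (indicator B) - indicator B x) = 0"
    proof (cases "T \<subseteq> B")
      case True
      then have "ball_average M T (indicator B) = 1"
        using ball_measure_pos[OF Tb]
        by (simp add: ball_average_def set_integral_indicator_ball[OF B Tb] Int_absorb2)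
      then show ?thesis using True T by auto
    next
      case False
      have "T \<inter> B = {}"
      proof (rule ccontr)
        assume "T \<inter> B \<noteq> {}"
        then obtain z where "z \<in> T" "z \<in> B" by auto
        then show False using all_balls_nested[OF B Tb, of z] T False by auto
      qed
      moreover have "x \<notin> B" using \<open>T \<inter> B = {}\<close> T by auto
      ultimately show ?thesis
        by (simp add: ball_average_def set_integral_indicator_ball[OF B Tb])
    qed
  next
    fix T assume "T \<in> chain B - {T \<in> nontrivial_balls. x \<in> T}"
    then have "x \<notin> T" "x \<notin> B" by (auto simp: chain_def)
    then show "- (C T * centred_indicator B T x) = 0" by (simp add: centred_indicator_def)
  next
    fix T assume T: "T \<in> chain B \<inter> {T \<in> nontrivial_balls. x \<in> T}"
    then have "T \<inter> B = B" "T \<in> all_balls" by (auto simp: chain_def nontrivial_ball)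
    then show "- (C T * centred_indicator B T x) =
        C T * (ball_average M T (indicator B) - indicator B x)"
      using T by (simp add: centred_indicator_def ball_average_def set_integral_indicator_ball[OF B] algebra_simps)
  qed
  finally show ?thesis .
qed

abbreviation L :: "('a \<Rightarrow> real) \<Rightarrow> 'a \<Rightarrow> real" where
  "L \<equiv> hierarchical_laplacian M C"

lemma laplacian_indicator:
  assumes "B \<in> all_balls"
  shows "L (indicator B) x = (\<Sum>\<^sub>\<infinity>T\<in>chain B. C T * centred_indicator B T x)"
  using infsumI[OF laplacian_terms_indicator[OF assms, of x]]
  by (simp add: hierarchical_laplacian_def)

lemma test_function_set_integrable:
  assumes "f \<in> test_functions" "T \<in> all_balls"
  shows "set_integrable M T f"
  unfolding set_integrable_def
  using integrable_mult_indicator[OF ball_sets[OF assms(2)] test_functions_integrable[OF assms(1)]] .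

lemma ball_average_lincomb:
  assumes f: "f \<in> test_functions" and g: "g \<in> test_functions" and T: "T \<in> all_balls"
  shows "ball_average M T (\<lambda>x. a * f x + b * g x) = a * ball_average M T f + b * ball_average M T g"
proof -
  have i: "set_integrable M T (\<lambda>x. a * f x)" "set_integrable M T (\<lambda>x. b * g x)"
    using f g T test_function_set_integrable by (auto intro: set_integrable_mult_right)
  have "(LINT x:T|M. a * f x + b * g x) = a * (LINT x:T|M. f x) + b * (LINT x:T|M. g x)"
    using set_integral_add(2)[OF i] by simp
  then show ?thesis by (simp add: ball_average_def distrib_left)
qed

text \<open>\<open>infsum\<close> returns 0 on families that are not summable, so additivity of
  \<open>L\<close> needs this beforehand.\<close>

lemma laplacian_summable:
  assumes "f \<in> test_functions"
  shows "(\<lambda>T. C T * (ball_average M T f - f x)) summable_on {T \<in> nontrivial_balls. x \<in> T}"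
  using assms
proof (induction rule: test_functions_induct)
  case zero
  then show ?case by (simp add: ball_average_def)
next
  case (add a B g)
  have "(\<lambda>T. a * (C T * (ball_average M T (indicator B) - indicator B x)) +
      C T * (ball_average M T g - g x)) summable_on {T \<in> nontrivial_balls. x \<in> T}"
    using laplacian_terms_indicator[OF add(1), of x] add(3)
    by (intro summable_on_add summable_on_cmult_right) (auto simp: summable_on_def)
  moreover have "a * (C T * (ball_average M T (indicator B) - indicator B x)) +
      C T * (ball_average M T g - g x) =
      C T * (ball_average M T (\<lambda>x. a * indicator B x + g x) - (a * indicator B x + g x))"
    if "T \<in> {T \<in> nontrivial_balls. x \<in> T}" for T
    using that ball_average_lincomb[OF ball_indicator_test_function[OF add(1)] add(2), of T a 1]
    by (simp add: nontrivial_ball algebra_simps)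
  ultimately show ?case
    using summable_on_cong by (metis (mono_tags, lifting))
qed

lemma laplacian_lincomb:
  assumes f: "f \<in> test_functions" and g: "g \<in> test_functions"
  shows "L (\<lambda>x. a * f x + b * g x) x = a * L f x + b * L g x"
proof -
  let ?A = "{T \<in> nontrivial_balls. x \<in> T}"
  have "(\<Sum>\<^sub>\<infinity>T\<in>?A. C T * (ball_average M T (\<lambda>x. a * f x + b * g x) - (a * f x + b * g x))) =
      (\<Sum>\<^sub>\<infinity>T\<in>?A. a * (C T * (ball_average M T f - f x)) + b * (C T * (ball_average M T g - g x)))"
    by (rule infsum_cong) (simp add: ball_average_lincomb[OF f g] nontrivial_ball algebra_simps)
  also have "\<dots> = (\<Sum>\<^sub>\<infinity>T\<in>?A. a * (C T * (ball_average M T f - f x))) +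
      (\<Sum>\<^sub>\<infinity>T\<in>?A. b * (C T * (ball_average M T g - g x)))"
    by (intro infsum_add summable_on_cmult_right laplacian_summable f g)
  finally show ?thesis
    by (simp add: hierarchical_laplacian_def infsum_cmult_right')
qed

lemma laplacian_zero: "L (\<lambda>_. 0) = (\<lambda>_. 0)"
  by (simp add: fun_eq_iff hierarchical_laplacian_def ball_average_def)

lemma haar_fun_test_function:
  assumes "B \<in> all_balls" "B' \<in> all_balls"
  shows "haar_fun M B B' \<in> test_functions"
  using function_subspace_add_scale[OF function_subspace_test_functions
      ball_indicator_test_function[OF assms(1)] ball_indicator_test_function[OF assms(2)],
      of "1 / measure M B" "- (1 / measure M B')"]
  by (simp add: haar_fun_def[abs_def])

lemma laplacian_haar_fun:
  assumes B': "B' \<in> nontrivial_balls" and pred: "immediate_predecessor B' B"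
  shows "L (haar_fun M B B') x = hlambda C B' * haar_fun M B B' x"
proof -
  define h where "h S = indicator S x / measure M S" for S
  have B: "B \<in> all_balls" "B' \<in> all_balls" and BB': "B \<subset> B'"
    and least: "\<And>T. T \<in> all_balls \<Longrightarrow> B \<subset> T \<Longrightarrow> B' \<subseteq> T"
    using pred by (auto simp: immediate_predecessor_def)
  have hsum: "L (indicator S) x / measure M S = (\<Sum>\<^sub>\<infinity>T\<in>chain S. C T * (h S - h T))"
    and hsummable: "(\<lambda>T. C T * (h S - h T)) summable_on chain S" if S: "S \<in> all_balls" for S
  proof -
    have eq: "C T * (h S - h T) = (1 / measure M S) * (C T * centred_indicator S T x)"
      if "T \<in> chain S" for T
      using chain_measures[OF S that] by (simp add: h_def centred_indicator_def field_simps)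
    have "(\<Sum>\<^sub>\<infinity>T\<in>chain S. C T * (h S - h T)) =
        (\<Sum>\<^sub>\<infinity>T\<in>chain S. (1 / measure M S) * (C T * centred_indicator S T x))"
      by (rule infsum_cong) (rule eq)
    then show "L (indicator S) x / measure M S = (\<Sum>\<^sub>\<infinity>T\<in>chain S. C T * (h S - h T))"
      by (simp only: infsum_cmult_right' laplacian_indicator[OF S]) simp
    have "(\<lambda>T. (1 / measure M S) * (C T * centred_indicator S T x)) summable_on chain S"
      by (rule summable_on_cmult_right[OF centred_indicator_summable[OF S]])
    also have "?this \<longleftrightarrow> (\<lambda>T. C T * (h S - h T)) summable_on chain S"
      by (rule summable_on_cong) (rule eq[symmetric])
    finally show "(\<lambda>T. C T * (h S - h T)) summable_on chain S" .
  qed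
  \<comment> \<open>As B' is the least ball strictly above B, strictly containing B is the same as
    containing B'. This is where the sum defining \<open>hlambda C B'\<close> appears.\<close>
  have ch: "chain B = {T \<in> nontrivial_balls. B' \<subseteq> T}"
    using BB' least nontrivial_ball by (auto simp: chain_def)
  \<comment> \<open>Passing from \<open>chain B'\<close> to \<open>chain B\<close> adds only T = B',
    whose term is zero.\<close>
  have ext: "(\<lambda>T. C T * (h B' - h T)) summable_on chain B \<longleftrightarrow>
      (\<lambda>T. C T * (h B' - h T)) summable_on chain B'"
    by (rule summable_on_cong_neutral) (auto simp: ch chain_def[of B'])
  have ext': "(\<Sum>\<^sub>\<infinity>T\<in>chain B. C T * (h B' - h T)) = (\<Sum>\<^sub>\<infinity>T\<in>chain B'. C T * (h B' - h T))"
    by (rule infsum_cong_neutral) (auto simp: ch chain_def[of B'])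
  have "L (haar_fun M B B') x = 1 / measure M B * L (indicator B) x +
      (- (1 / measure M B')) * L (indicator B') x"
    using laplacian_lincomb[OF ball_indicator_test_function[OF B(1)]
        ball_indicator_test_function[OF B(2)], of "1 / measure M B" "- (1 / measure M B')" x]
    by (simp add: haar_fun_def[abs_def])
  also have "\<dots> = (\<Sum>\<^sub>\<infinity>T\<in>chain B. C T * (h B - h T)) - (\<Sum>\<^sub>\<infinity>T\<in>chain B. C T * (h B' - h T))"
    using hsum[OF B(1)] hsum[OF B(2)] ext' by simp
  also have "\<dots> = (\<Sum>\<^sub>\<infinity>T\<in>chain B. C T * (h B - h T)) + (\<Sum>\<^sub>\<infinity>T\<in>chain B. - (C T * (h B' - h T)))"
    by (simp add: infsum_uminus)
  also have "\<dots> = (\<Sum>\<^sub>\<infinity>T\<in>chain B. C T * (h B - h T) + - (C T * (h B' - h T)))"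
    using hsummable[OF B(1)] iffD2[OF ext hsummable[OF B(2)]]
    by (intro infsum_add[symmetric]) (simp_all add: summable_on_uminus)
  also have "\<dots> = (\<Sum>\<^sub>\<infinity>T\<in>chain B. C T * (h B - h B'))"
    by (simp add: algebra_simps)
  also have "\<dots> = hlambda C B' * (h B - h B')"
    by (simp add: infsum_cmult_left' hlambda_def ch)
  finally show ?thesis
    by (simp add: h_def haar_fun_def)
qed

section \<open>Square-integrability of L applied to a ball indicator\<close>

lemma centred_indicator_integrable:
  assumes "B \<in> all_balls" "T \<in> chain B"
  shows "integrable M (centred_indicator B T)"
  unfolding centred_indicator_def[abs_def]
  using integrable_ball_indicator[OF assms(1)] integrable_ball_indicator[OF chain_ball[OF assms(2)]]
  by (intro Bochner_Integration.integrable_diff integrable_mult_right) auto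

lemma integral_ball_indicator: "(LINT x|M. indicator B x :: real) = measure M B"
  by (simp add: space_M)

text \<open>1_B and the multiple of 1_T subtracted from it have the same integral m(B), so the bound
  is uniform in T.\<close>

lemma centred_indicator_L1:
  assumes "B \<in> all_balls" "T \<in> chain B"
  shows "(LINT x|M. \<bar>centred_indicator B T x\<bar>) \<le> 2 * measure M B"
proof -
  have i: "integrable M (indicator B :: 'a \<Rightarrow> real)" "integrable M (indicator T :: 'a \<Rightarrow> real)"
    using integrable_ball_indicator[OF assms(1)] integrable_ball_indicator[OF chain_ball[OF assms(2)]] .
  have "(LINT x|M. \<bar>centred_indicator B T x\<bar>) \<le>
      (LINT x|M. indicator B x + measure M B / measure M T * indicator T x)"
  proof (rule integral_mono)
    show "integrable M (\<lambda>x. \<bar>centred_indicator B T x\<bar>)"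
      using centred_indicator_integrable[OF assms] by simp
    show "integrable M (\<lambda>x. indicator B x + measure M B / measure M T * indicator T x)"
      using i by (intro Bochner_Integration.integrable_add integrable_mult_right)
    show "\<bar>centred_indicator B T x\<bar> \<le> indicator B x + measure M B / measure M T * indicator T x" for x
      unfolding centred_indicator_def by (rule order_trans[OF abs_triangle_ineq4]) (simp add: abs_mult)
  qed
  also have "\<dots> = measure M B + measure M B / measure M T * measure M T"
    using i by (simp add: integral_ball_indicator space_M)
  also have "\<dots> = 2 * measure M B" using chain_measures(3)[OF assms] by simp
  finally show ?thesis .
qed

text \<open>The point x only centres the exhausting balls; the limit in n does not depend on
  it.\<close>

definition laplacian_partial :: "'a \<Rightarrow> 'a set \<Rightarrow> nat \<Rightarrow> 'a \<Rightarrow> real" where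
  "laplacian_partial x B n y = (\<Sum>T\<in>chain_upto x B n. C T * centred_indicator B T y)"

lemma chain_upto_chain: "T \<in> chain_upto x B n \<Longrightarrow> T \<in> chain B"
  by (simp add: chain_upto_def)

lemma laplacian_partial_LIMSEQ:
  assumes "B \<in> all_balls"
  shows "(\<lambda>n. laplacian_partial x B n y) \<longlonglongrightarrow> L (indicator B) y"
  unfolding laplacian_partial_def laplacian_indicator[OF assms]
  by (rule has_sum_chain_LIMSEQ[OF assms has_sum_infsum[OF centred_indicator_summable[OF assms]]])

lemma abs_laplacian_partial_le:
  assumes "B \<in> all_balls"
  shows "\<bar>laplacian_partial x B n y\<bar> \<le> (\<Sum>T\<in>chain_upto x B n. C T * \<bar>centred_indicator B T y\<bar>)"
proof -
  have "\<bar>laplacian_partial x B n y\<bar> \<le> (\<Sum>T\<in>chain_upto x B n. \<bar>C T * centred_indicator B T y\<bar>)"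
    unfolding laplacian_partial_def by (rule sum_abs)
  also have "\<dots> = (\<Sum>T\<in>chain_upto x B n. C T * \<bar>centred_indicator B T y\<bar>)"
  proof (rule sum.cong[OF refl])
    fix T assume "T \<in> chain_upto x B n"
    then have "0 < C T" by (intro C_chain_pos chain_upto_chain)
    then show "\<bar>C T * centred_indicator B T y\<bar> = C T * \<bar>centred_indicator B T y\<bar>"
      by (simp add: abs_mult)
  qed
  finally show ?thesis .
qed

lemma laplacian_partial_bound:
  assumes B: "B \<in> all_balls"
  shows "\<bar>laplacian_partial x B n y\<bar> \<le> chain_sum B"
proof -
  have "(\<Sum>T\<in>chain_upto x B n. C T * \<bar>centred_indicator B T y\<bar>) \<le> (\<Sum>T\<in>chain_upto x B n. C T * 1)"
  proof (intro sum_mono mult_left_mono)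
    fix T assume T: "T \<in> chain_upto x B n"
    show "\<bar>centred_indicator B T y\<bar> \<le> 1" by (rule centred_indicator_bound[OF B chain_upto_chain[OF T]])
    show "0 \<le> C T" by (rule less_imp_le[OF C_chain_pos[OF chain_upto_chain[OF T]]])
  qed
  then show ?thesis
    using abs_laplacian_partial_le[OF B, of x n y] sum_C_le_chain_sum[OF B, of x n] by simp
qed

lemma laplacian_partial_L2:
  assumes B: "B \<in> all_balls"
  shows "laplacian_partial x B n \<in> L2 M"
  unfolding laplacian_partial_def[abs_def]
proof (rule function_subspace_sum[OF function_subspace_L2 finite_chain_upto[OF B]])
  fix T assume T: "T \<in> chain_upto x B n"
  show "centred_indicator B T \<in> L2 M"
    using L2_lincomb[OF ball_indicator_L2[OF B] ball_indicator_L2[OF chain_ball[OF chain_upto_chain[OF T]]],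
        of 1 "- (measure M B / measure M T)"]
    by (simp add: centred_indicator_def[abs_def])
qed

text \<open>Bounding one factor of the square by \<open>chain_sum B\<close> reduces the \<open>L\<^sup>2\<close> estimate to the
  \<open>L\<^sup>1\<close> norms of the summands.\<close>

lemma laplacian_partial_square_integral:
  assumes B: "B \<in> all_balls"
  shows "(LINT y|M. (laplacian_partial x B n y)\<^sup>2) \<le> 2 * measure M B * (chain_sum B)\<^sup>2"
proof -
  have i': "integrable M (\<lambda>y. \<bar>centred_indicator B T y\<bar>)" if "T \<in> chain_upto x B n" for T
    using centred_indicator_integrable[OF B chain_upto_chain[OF that]] by simp
  then have i: "integrable M (\<lambda>y. C T * \<bar>centred_indicator B T y\<bar>)" if "T \<in> chain_upto x B n" for T
    using that by simp
  have "(LINT y|M. (laplacian_partial x B n y)\<^sup>2) \<le>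
      (LINT y|M. chain_sum B * (\<Sum>T\<in>chain_upto x B n. C T * \<bar>centred_indicator B T y\<bar>))"
  proof (rule integral_mono)
    show "integrable M (\<lambda>y. (laplacian_partial x B n y)\<^sup>2)"
      using laplacian_partial_L2[OF B] by (simp add: L2_def)
    show "integrable M (\<lambda>y. chain_sum B * (\<Sum>T\<in>chain_upto x B n. C T * \<bar>centred_indicator B T y\<bar>))"
      using i' by (intro integrable_mult_right Bochner_Integration.integrable_sum)
    fix y
    have "(laplacian_partial x B n y)\<^sup>2 = \<bar>laplacian_partial x B n y\<bar> * \<bar>laplacian_partial x B n y\<bar>"
      by (simp add: power2_eq_square)
    also have "\<dots> \<le> chain_sum B * (\<Sum>T\<in>chain_upto x B n. C T * \<bar>centred_indicator B T y\<bar>)"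
      by (intro mult_mono laplacian_partial_bound[OF B] abs_laplacian_partial_le[OF B] chain_sum_nonneg) simp
    finally show "(laplacian_partial x B n y)\<^sup>2 \<le>
        chain_sum B * (\<Sum>T\<in>chain_upto x B n. C T * \<bar>centred_indicator B T y\<bar>)" .
  qed
  also have "\<dots> = chain_sum B * (\<Sum>T\<in>chain_upto x B n. C T * (LINT y|M. \<bar>centred_indicator B T y\<bar>))"
  proof -
    have "(LINT y|M. (\<Sum>T\<in>chain_upto x B n. C T * \<bar>centred_indicator B T y\<bar>)) =
        (\<Sum>T\<in>chain_upto x B n. LINT y|M. C T * \<bar>centred_indicator B T y\<bar>)"
      by (rule Bochner_Integration.integral_sum[OF i])
    then show ?thesis by simp
  qed
  also have "\<dots> \<le> chain_sum B * (\<Sum>T\<in>chain_upto x B n. C T * (2 * measure M B))"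
  proof (intro mult_left_mono sum_mono chain_sum_nonneg)
    fix T assume T: "T \<in> chain_upto x B n"
    show "(LINT y|M. \<bar>centred_indicator B T y\<bar>) \<le> 2 * measure M B"
      by (rule centred_indicator_L1[OF B chain_upto_chain[OF T]])
    show "0 \<le> C T" by (rule less_imp_le[OF C_chain_pos[OF chain_upto_chain[OF T]]])
  qed
  also have "\<dots> = chain_sum B * (sum C (chain_upto x B n) * (2 * measure M B))"
    by (simp add: sum_distrib_right)
  also have "\<dots> \<le> chain_sum B * (chain_sum B * (2 * measure M B))"
    by (intro mult_left_mono mult_right_mono chain_sum_nonneg sum_C_le_chain_sum[OF B]) simp
  finally show ?thesis by (simp add: power2_eq_square mult.commute mult.left_commute)
qed

text \<open>The bound is kept along with the membership: when m(X) is finite and B grows, its factor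
  \<open>chain_sum B\<close> makes L 1_B tend to 0 in L2.\<close>

lemma laplacian_indicator_L2:
  assumes "B \<in> all_balls"
  shows "L (indicator B) \<in> L2 M"
    and "(LINT y|M. (L (indicator B) y)\<^sup>2) \<le> 2 * measure M B * (chain_sum B)\<^sup>2"
  using L2_Fatou[OF laplacian_partial_L2[OF assms] laplacian_partial_LIMSEQ[OF assms]
      laplacian_partial_square_integral[OF assms]] .

lemma laplacian_add_indicator:
  assumes "B \<in> all_balls" "g \<in> test_functions"
  shows "L (\<lambda>x. a * indicator B x + g x) = (\<lambda>x. a * L (indicator B) x + L g x)"
  using laplacian_lincomb[OF ball_indicator_test_function[OF assms(1)] assms(2), of a 1]
  by (simp add: fun_eq_iff)

lemma laplacian_L2:
  assumes "f \<in> test_functions" shows "L f \<in> L2 M"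
  using assms
proof (induction rule: test_functions_induct)
  case zero
  then show ?case by (simp add: laplacian_zero L2_zero)
next
  case (add a B g)
  then show ?case
    using L2_lincomb[OF laplacian_indicator_L2(1)[OF add(1)] add(3), of a 1]
    by (simp add: laplacian_add_indicator)
qed

section \<open>The quadratic form\<close>

text \<open>\<open>\<langle>f - P\<^sub>T f, g\<rangle>\<close> in \<open>L\<^sup>2(T)\<close>.\<close>

definition ball_form :: "'a set \<Rightarrow> ('a \<Rightarrow> real) \<Rightarrow> ('a \<Rightarrow> real) \<Rightarrow> real" where
  "ball_form T f g = L2_inner M (\<lambda>x. indicator T x * f x) g
     - L2_inner M f (indicator T) * L2_inner M g (indicator T) / measure M T"

lemma indicator_times_L2:
  assumes "f \<in> L2 M" "T \<in> all_balls"
  shows "(\<lambda>x. indicator T x * f x) \<in> L2 M"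
proof -
  have "integrable M (\<lambda>x. indicator T x * (f x)\<^sup>2)"
    using integrable_mult_indicator[OF ball_sets[OF assms(2)], of "\<lambda>x. (f x)\<^sup>2"] assms(1)
    by (simp add: L2_def)
  moreover have "(indicator T x * f x)\<^sup>2 = indicator T x * (f x)\<^sup>2" for x
    by (simp add: indicator_def)
  moreover have "(\<lambda>x. indicator T x * f x) \<in> borel_measurable M"
    using L2_measurable[OF assms(1)] ball_sets[OF assms(2)] by measurable
  ultimately show ?thesis by (simp add: L2_def)
qed

lemma ball_form_commute: "ball_form T f g = ball_form T g f"
  by (simp add: ball_form_def L2_inner_def mult_ac)

text \<open>This is m(T) times the variance of f on T: Cauchy-Schwarz for 1_T f and 1_T, the latter
  having squared norm m(T).\<close>

lemma ball_form_nonneg: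
  assumes f: "f \<in> L2 M" and T: "T \<in> all_balls"
  shows "0 \<le> ball_form T f f"
proof -
  let ?g = "\<lambda>x. indicator T x * f x"
  have gL: "?g \<in> L2 M" by (rule indicator_times_L2[OF f T])
  have 1: "L2_inner M f (indicator T) = L2_inner M ?g (indicator T)"
    unfolding L2_inner_def by (rule Bochner_Integration.integral_cong) (auto simp: indicator_def)
  have 2: "L2_inner M ?g f = (L2_norm M ?g)\<^sup>2"
    unfolding L2_norm_sq L2_inner_def
    by (rule Bochner_Integration.integral_cong) (auto simp: indicator_def)
  have 3: "(L2_norm M (indicator T))\<^sup>2 = measure M T"
  proof -
    have "(L2_norm M (indicator T))\<^sup>2 = (LINT x|M. indicator T x)"
      unfolding L2_norm_sq L2_inner_def
      by (rule Bochner_Integration.integral_cong) (auto simp: indicator_def)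
    then show ?thesis by (simp only: integral_ball_indicator)
  qed
  have "(L2_inner M ?g (indicator T))\<^sup>2 \<le> (L2_norm M ?g * L2_norm M (indicator T))\<^sup>2"
    using power_mono[OF L2_Cauchy_Schwarz[OF gL ball_indicator_L2[OF T]], of 2] by simp
  also have "\<dots> = (L2_norm M ?g)\<^sup>2 * measure M T" by (simp add: power_mult_distrib 3)
  finally have "(L2_inner M ?g (indicator T))\<^sup>2 / measure M T \<le> (L2_norm M ?g)\<^sup>2"
    using ball_measure_pos[OF T] by (simp add: pos_divide_le_eq)
  then show ?thesis
    unfolding ball_form_def 1 2 by (simp add: power2_eq_square)
qed

lemma ball_form_lincomb:
  assumes f: "f \<in> L2 M" and g: "g \<in> L2 M" and h: "h \<in> L2 M" and T: "T \<in> all_balls"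
  shows "ball_form T (\<lambda>x. a * f x + b * g x) h = a * ball_form T f h + b * ball_form T g h"
proof -
  have "L2_inner M (\<lambda>x. indicator T x * (a * f x + b * g x)) h =
      L2_inner M (\<lambda>x. a * (indicator T x * f x) + b * (indicator T x * g x)) h"
    by (simp add: algebra_simps)
  also have "\<dots> = a * L2_inner M (\<lambda>x. indicator T x * f x) h + b * L2_inner M (\<lambda>x. indicator T x * g x) h"
    by (intro L2_inner_lincomb indicator_times_L2 f g h T)
  finally show ?thesis
    using L2_inner_lincomb[OF f g ball_indicator_L2[OF T], of a b]
    by (simp add: ball_form_def algebra_simps add_divide_distrib)
qed

lemma centred_indicator_inner:
  assumes B: "B \<in> all_balls" and T: "T \<in> chain B" and g: "g \<in> L2 M"
  shows "L2_inner M (centred_indicator B T) g = ball_form T (indicator B) g"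
proof -
  have Tb: "T \<in> all_balls" "B \<subseteq> T" using T chain_ball by (auto simp: chain_def)
  have "L2_inner M (centred_indicator B T) g =
      L2_inner M (indicator B) g - measure M B / measure M T * L2_inner M (indicator T) g"
    using L2_inner_lincomb[OF ball_indicator_L2[OF B] ball_indicator_L2[OF Tb(1)] g,
        of 1 "- (measure M B / measure M T)"]
    by (simp add: centred_indicator_def[abs_def])
  moreover have "(\<lambda>x. indicator T x * indicator B x) = (indicator B :: 'a \<Rightarrow> real)"
    using Tb by (auto simp: fun_eq_iff indicator_def)
  moreover have "L2_inner M (indicator B) (indicator T) = measure M B"
  proof -
    have "L2_inner M (indicator B) (indicator T) = (LINT x|M. indicator B x)"
      unfolding L2_inner_def using Tb
      by (intro Bochner_Integration.integral_cong) (auto simp: indicator_def)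
    then show ?thesis by (simp only: integral_ball_indicator)
  qed
  ultimately show ?thesis
    by (simp add: ball_form_def L2_inner_commute[of M g])
qed

text \<open>Such a T is inside B or disjoint from it, so 1_B is constant on T, and subtracting the
  average over T annihilates constants.\<close>

lemma ball_form_outside_chain:
  assumes B: "B \<in> all_balls" and T: "T \<in> all_balls" "\<not> B \<subset> T"
  shows "ball_form T (indicator B) g = 0"
proof (cases "T \<subseteq> B")
  case True
  then have e: "(\<lambda>x. indicator T x * indicator B x) = (indicator T :: 'a \<Rightarrow> real)"
    by (auto simp: fun_eq_iff indicator_def)
  have "L2_inner M (indicator B) (indicator T) = (LINT x|M. indicator T x)"
    unfolding L2_inner_def using True
    by (intro Bochner_Integration.integral_cong) (auto simp: indicator_def)
  then have "L2_inner M (indicator B) (indicator T) = measure M T"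
    by (simp only: integral_ball_indicator)
  then show ?thesis
    using ball_measure_pos[OF T(1)] unfolding ball_form_def e by (simp add: L2_inner_commute[of M g])
next
  case False
  have "T \<inter> B = {}"
  proof (rule ccontr)
    assume "T \<inter> B \<noteq> {}"
    then obtain z where "z \<in> T" "z \<in> B" by auto
    then show False using all_balls_nested[OF B T(1), of z] T False by auto
  qed
  then have e: "indicator T x * indicator B x = (0::real)" "indicator B x * indicator T x = (0::real)" for x
    by (auto simp: indicator_def)
  show ?thesis
    unfolding ball_form_def L2_inner_def e by simp
qed

text \<open>Sum and integral are interchanged by dominated convergence: the truncated sums are
  bounded by \<open>chain_sum B\<close> everywhere and g is integrable. The sum over
  \<open>chain B\<close> is then extended by zero terms to all nontrivial balls.\<close>

lemma laplacian_form_indicator: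
  assumes B: "B \<in> all_balls" and g: "g \<in> test_functions"
  shows "((\<lambda>T. C T * ball_form T (indicator B) g) has_sum L2_inner M (L (indicator B)) g)
    nontrivial_balls"
proof -
  have gL: "g \<in> L2 M" using g test_functions_L2 by auto
  have gi: "integrable M g" by (rule test_functions_integrable[OF g])
  have ci: "integrable M (\<lambda>y. centred_indicator B T y * g y)" if "T \<in> chain B" for T
    using L2_lincomb[OF ball_indicator_L2[OF B] ball_indicator_L2[OF chain_ball[OF that]],
        of 1 "- (measure M B / measure M T)"]
    by (intro L2_integrable_mult[OF _ gL]) (simp add: centred_indicator_def[abs_def])
  have bd: "\<bar>L2_inner M (centred_indicator B T) g\<bar> \<le> (LINT y|M. \<bar>g y\<bar>)" if T: "T \<in> chain B" for T
  proof -
    have "\<bar>L2_inner M (centred_indicator B T) g\<bar> \<le> (LINT y|M. \<bar>centred_indicator B T y * g y\<bar>)"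
      unfolding L2_inner_def by (rule integral_abs_bound)
    also have "\<dots> \<le> (LINT y|M. \<bar>g y\<bar>)"
    proof (rule integral_mono)
      show "\<bar>centred_indicator B T y * g y\<bar> \<le> \<bar>g y\<bar>" for y
        using mult_right_mono[OF centred_indicator_bound[OF B T, of y], of "\<bar>g y\<bar>"] by (simp add: abs_mult)
    qed (use ci[OF T] gi in auto)
    finally show ?thesis .
  qed
  let ?s = "\<lambda>T. C T * L2_inner M (centred_indicator B T) g"
  have summable: "?s summable_on chain B"
    by (rule C_bounded_summable[OF B bd])
  \<comment> \<open>Any point serves as the centre of the exhausting balls.\<close>
  obtain x :: 'a where True by simp
  have "(\<lambda>n. sum ?s (chain_upto x B n)) \<longlonglongrightarrow> infsum ?s (chain B)"
    by (rule has_sum_chain_LIMSEQ[OF B has_sum_infsum[OF summable]])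
  moreover have "(\<lambda>n. sum ?s (chain_upto x B n)) \<longlonglongrightarrow> L2_inner M (L (indicator B)) g"
  proof -
    have "(\<lambda>n. LINT y|M. laplacian_partial x B n y * g y) \<longlonglongrightarrow> (LINT y|M. L (indicator B) y * g y)"
    proof (rule integral_dominated_convergence)
      show "integrable M (\<lambda>y. chain_sum B * \<bar>g y\<bar>)" using gi by simp
      show "AE y in M. (\<lambda>n. laplacian_partial x B n y * g y) \<longlonglongrightarrow> L (indicator B) y * g y"
        by (intro AE_I2 tendsto_mult_right laplacian_partial_LIMSEQ[OF B])
      show "AE y in M. norm (laplacian_partial x B n y * g y) \<le> chain_sum B * \<bar>g y\<bar>" for n
        using laplacian_partial_bound[OF B, of x n] by (intro AE_I2) (simp add: abs_mult mult_right_mono)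
      show "(\<lambda>y. L (indicator B) y * g y) \<in> borel_measurable M"
        using L2_measurable[OF laplacian_indicator_L2(1)[OF B]] L2_measurable[OF gL] by measurable
      show "(\<lambda>y. laplacian_partial x B n y * g y) \<in> borel_measurable M" for n
        using L2_measurable[OF laplacian_partial_L2[OF B, of x n]] L2_measurable[OF gL] by measurable
    qed
    moreover have "(LINT y|M. laplacian_partial x B n y * g y) = sum ?s (chain_upto x B n)" for n
    proof -
      have "(LINT y|M. laplacian_partial x B n y * g y) =
          (LINT y|M. (\<Sum>T\<in>chain_upto x B n. C T * (centred_indicator B T y * g y)))"
        by (simp add: laplacian_partial_def sum_distrib_right mult.assoc)
      also have "\<dots> = (\<Sum>T\<in>chain_upto x B n. (LINT y|M. C T * (centred_indicator B T y * g y)))"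
        using ci by (intro Bochner_Integration.integral_sum integrable_mult_right) (auto dest: chain_upto_chain)
      finally show ?thesis by (simp add: L2_inner_def)
    qed
    ultimately show ?thesis by (simp add: L2_inner_def)
  qed
  ultimately have "infsum ?s (chain B) = L2_inner M (L (indicator B)) g"
    by (rule LIMSEQ_unique)
  then have "(?s has_sum L2_inner M (L (indicator B)) g) (chain B)"
    using has_sum_infsum[OF summable] by simp
  also have "?this \<longleftrightarrow> ?thesis"
  proof (rule has_sum_cong_neutral)
    show "C T * ball_form T (indicator B) g = 0" if "T \<in> nontrivial_balls - chain B" for T
      using that by (simp add: ball_form_outside_chain[OF B] nontrivial_ball chain_def)
    show "?s T = 0" if "T \<in> chain B - nontrivial_balls" for T
      using that by (auto simp: chain_def)
    show "?s T = C T * ball_form T (indicator B) g" if "T \<in> chain B \<inter> nontrivial_balls" for T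
      using that centred_indicator_inner[OF B _ gL] by simp
  qed
  finally show ?thesis .
qed

text \<open>With all nontrivial balls as common index set, the expansions for the indicators that
  make up f can be added term by term. Symmetry and non-negativity of \<open>L\<close> are then read
  off from \<open>ball_form\<close>.\<close>

lemma laplacian_form:
  assumes f: "f \<in> test_functions" and g: "g \<in> test_functions"
  shows "((\<lambda>T. C T * ball_form T f g) has_sum L2_inner M (L f) g) nontrivial_balls"
  using f
proof (induction rule: test_functions_induct)
  case zero
  then show ?case by (simp add: laplacian_zero ball_form_def L2_inner_def)
next
  case (add a B f)
  have L2: "indicator B \<in> L2 M" "f \<in> L2 M" "g \<in> L2 M"
    using add g test_functions_L2 ball_indicator_L2 by auto
  have form: "a * (C T * ball_form T (indicator B) g) + C T * ball_form T f g =
      C T * ball_form T (\<lambda>x. a * indicator B x + f x) g" if "T \<in> nontrivial_balls" for T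
    using ball_form_lincomb[OF L2 nontrivial_ball[OF that], of a 1] by (simp add: algebra_simps)
  have inner: "L2_inner M (L (\<lambda>x. a * indicator B x + f x)) g =
      a * L2_inner M (L (indicator B)) g + L2_inner M (L f) g"
    using L2_inner_lincomb[OF laplacian_indicator_L2(1)[OF add(1)] laplacian_L2[OF add(2)] L2(3), of a 1]
    by (simp add: laplacian_add_indicator[OF add(1,2)])
  have "((\<lambda>T. a * (C T * ball_form T (indicator B) g) + C T * ball_form T f g) has_sum
      (a * L2_inner M (L (indicator B)) g + L2_inner M (L f) g)) nontrivial_balls"
    by (intro has_sum_add has_sum_cmult_right laplacian_form_indicator add g)
  also have "?this \<longleftrightarrow> ((\<lambda>T. C T * ball_form T (\<lambda>x. a * indicator B x + f x) g) has_sum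
      (a * L2_inner M (L (indicator B)) g + L2_inner M (L f) g)) nontrivial_balls"
    by (rule has_sum_cong) (rule form)
  finally show ?case
    unfolding inner .
qed

lemma laplacian_symmetric: "symmetric_operator M L test_functions"
  unfolding symmetric_operator_def
proof (intro ballI)
  fix f g :: "'a \<Rightarrow> real" assume fg: "f \<in> test_functions" "g \<in> test_functions"
  have "((\<lambda>T. C T * ball_form T f g) has_sum L2_inner M (L g) f) nontrivial_balls"
    using laplacian_form[OF fg(2,1)] by (simp add: ball_form_commute[of _ g])
  then show "L2_inner M (L f) g = L2_inner M f (L g)"
    using has_sum_unique[OF laplacian_form[OF fg]] by (simp add: L2_inner_commute[of M f])
qed

lemma laplacian_nonneg: "nonneg_definite M L test_functions"
  unfolding nonneg_definite_def
proof
  fix f :: "'a \<Rightarrow> real" assume f: "f \<in> test_functions"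
  then have fL: "f \<in> L2 M" using test_functions_L2 by auto
  show "0 \<le> L2_inner M (L f) f"
  proof (rule has_sum_nonneg[OF laplacian_form[OF f f]])
    fix T :: "'a set" assume T: "T \<in> nontrivial_balls"
    show "0 \<le> C T * ball_form T f f"
      using C_pos[OF T] ball_form_nonneg[OF fL nontrivial_ball[OF T]] by simp
  qed
qed

section \<open>Completeness and essential self-adjointness\<close>

abbreviation exhaustion :: "'a \<Rightarrow> nat \<Rightarrow> 'a set" where
  "exhaustion x n \<equiv> ball x (real (Suc n))"

lemma exhaustion_ball: "exhaustion x n \<in> all_balls"
  by (intro ball_in_all_balls) simp

lemma incseq_exhaustion: "incseq (exhaustion x)"
  by (intro incseq_SucI subset_ball) simp

lemma UN_exhaustion: "(\<Union>n. exhaustion x n) = UNIV"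
proof -
  have "y \<in> (\<Union>n. exhaustion x n)" for y
  proof -
    obtain n where "dist x y < real n" using reals_Archimedean2 by blast
    then have "y \<in> exhaustion x n" by simp
    then show ?thesis by blast
  qed
  then show ?thesis by blast
qed

text \<open>Induction on the number of balls between B and T; one step is h_B - h_T = (h_B - h_B') +
  (h_B' - h_T) with B' the predecessor of B. W stays abstract because it will be a linear span once
  and the range of an operator once.\<close>

lemma haar_fun_in_subspace:
  assumes W: "function_subspace W"
    and haar: "\<And>B B'. immediate_predecessor B' B \<Longrightarrow> haar_fun M B B' \<in> W"
    and B: "B \<in> all_balls" and T: "T \<in> all_balls" and BT: "B \<subseteq> T"
  shows "haar_fun M B T \<in> W"
  using B BT
proof (induction "card {S \<in> all_balls. B \<subseteq> S \<and> S \<subseteq> T}" arbitrary: B rule: less_induct)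
  case less
  show ?case
  proof (cases "B = T")
    case True
    then show ?thesis using W by (simp add: haar_fun_def[abs_def] function_subspace_def)
  next
    case False
    then obtain B' where B': "immediate_predecessor B' B" "B' \<subseteq> T"
      using exists_immediate_predecessor[OF less.prems(1) T] less.prems(2) by blast
    then have B'b: "B' \<in> all_balls" "B \<subset> B'" by (auto simp: immediate_predecessor_def)
    have "card {S \<in> all_balls. B' \<subseteq> S \<and> S \<subseteq> T} < card {S \<in> all_balls. B \<subseteq> S \<and> S \<subseteq> T}"
    proof (rule psubset_card_mono[OF finite_balls_between[OF less.prems(1) T]])
      have "{S \<in> all_balls. B' \<subseteq> S \<and> S \<subseteq> T} \<subseteq> {S \<in> all_balls. B \<subseteq> S \<and> S \<subseteq> T}"
        using B'b by blast
      moreover have "B \<in> {S \<in> all_balls. B \<subseteq> S \<and> S \<subseteq> T}" using less.prems by blast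
      moreover have "B \<notin> {S \<in> all_balls. B' \<subseteq> S \<and> S \<subseteq> T}" using B'b by blast
      ultimately show "{S \<in> all_balls. B' \<subseteq> S \<and> S \<subseteq> T} \<subset> {S \<in> all_balls. B \<subseteq> S \<and> S \<subseteq> T}"
        by blast
    qed
    then have "haar_fun M B' T \<in> W" using less.hyps B'b(1) B'(2) by blast
    from function_subspace_add_scale[OF W haar[OF B'(1)] this, of 1 1]
    show ?thesis by (simp add: haar_fun_def[abs_def])
  qed
qed

lemma measure_exhaustion_limit:
  assumes "emeasure M (space M) < \<infinity>"
  shows "(\<lambda>n. measure M (exhaustion x n)) \<longlonglongrightarrow> measure M (space M)"
proof -
  interpret finite_measure M using assms by (intro finite_measureI) simp
  have "range (exhaustion x) \<subseteq> sets M" using ball_sets exhaustion_ball by blast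
  from finite_Lim_measure_incseq[OF this incseq_exhaustion]
  show ?thesis by (simp only: UN_exhaustion space_M)
qed

lemma measure_exhaustion_at_top:
  assumes "\<not> emeasure M (space M) < \<infinity>"
  shows "filterlim (\<lambda>n. measure M (exhaustion x n)) at_top sequentially"
proof -
  have "range (exhaustion x) \<subseteq> sets M" using ball_sets exhaustion_ball by blast
  from Lim_emeasure_incseq[OF this incseq_exhaustion]
  have "(\<lambda>n. emeasure M (exhaustion x n)) \<longlonglongrightarrow> top"
    using assms by (simp only: UN_exhaustion space_M not_less infinity_ennreal_def top_unique)
  then show ?thesis
    by (simp only: emeasure_ball[OF exhaustion_ball] ennreal_tendsto_top_eq_at_top)
qed

lemma const_L2:
  assumes "emeasure M (space M) < \<infinity>"
  shows "(\<lambda>_. c) \<in> L2 M"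
proof -
  interpret finite_measure M using assms by (intro finite_measureI) simp
  show ?thesis by (simp add: L2_def)
qed

text \<open>The square is affine in 1_T because 1_T is idempotent. The formula yields the distance
  of 1_T/m(T) from 1/m(X) and that of 1_T from 1.\<close>

lemma integral_ball_plus_const_square:
  assumes fin: "emeasure M (space M) < \<infinity>" and T: "T \<in> all_balls"
  shows "(LINT x|M. (a * indicator T x + b)\<^sup>2) =
    (a\<^sup>2 + 2 * a * b) * measure M T + b\<^sup>2 * measure M (space M)"
proof -
  interpret finite_measure M using fin by (intro finite_measureI) simp
  have "(LINT x|M. (a * indicator T x + b)\<^sup>2) = (LINT x|M. (a\<^sup>2 + 2 * a * b) * indicator T x + b\<^sup>2)"
    by (rule Bochner_Integration.integral_cong) (auto simp: indicator_def power2_sum)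
  also have "\<dots> = (LINT x|M. (a\<^sup>2 + 2 * a * b) * indicator T x) + (LINT x|M. b\<^sup>2)"
    using integrable_ball_indicator[OF T]
    by (intro Bochner_Integration.integral_add integrable_mult_right) auto
  also have "(LINT x|M. (a\<^sup>2 + 2 * a * b) * indicator T x) = (a\<^sup>2 + 2 * a * b) * measure M T"
    by (simp add: space_M)
  finally show ?thesis by (simp add: mult.commute)
qed

lemma space_measure_pos:
  assumes "emeasure M (space M) < \<infinity>"
  shows "0 < measure M (space M)"
proof -
  interpret finite_measure M using assms by (intro finite_measureI) simp
  have "measure M (exhaustion undefined 0) \<le> measure M (space M)" by (rule bounded_measure)
  then show ?thesis using ball_measure_pos[OF exhaustion_ball, of undefined 0] by linarith
qed

text \<open>\<open>1\<^sub>T/m(T)\<close> tends to the constant \<open>1/m(X)\<close> (to \<open>0\<close> if \<open>m(X)\<close> is infinite) as the ball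
  \<open>T\<close> grows to \<open>X\<close>.\<close>

lemma dense_if_haar_fun_in:
  assumes WL: "W \<subseteq> L2 M" and W: "function_subspace W"
    and haar: "\<And>B B'. immediate_predecessor B' B \<Longrightarrow> haar_fun M B B' \<in> W"
    and const: "emeasure M (space M) < \<infinity> \<Longrightarrow> (\<lambda>_. 1) \<in> L2_closure M W"
  shows "L2_dense M W"
proof -
  have clW: "function_subspace (L2_closure M W)" by (rule function_subspace_L2_closure[OF WL W])
  have ball: "indicator B \<in> L2_closure M W" if B: "B \<in> all_balls" for B
  proof -
    obtain x where "x \<in> B" using all_balls_nonempty[OF B] by auto
    let ?h = "\<lambda>y. 1 / measure M B * indicator B y"
    define c where "c = (if emeasure M (space M) < \<infinity> then 1 / measure M (space M) else 0)"
    have cW: "(\<lambda>_. c) \<in> L2_closure M W"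
    proof (cases "emeasure M (space M) < \<infinity>")
      case True
      from function_subspace_add_scale[OF clW const[OF True] const[OF True], of c 0]
      show ?thesis by simp
    next
      case False
      then show ?thesis using clW by (simp add: c_def function_subspace_def)
    qed
    have lim: "(\<lambda>n. L2_dist M ?h (\<lambda>y. haar_fun M B (exhaustion x n) y + c)) \<longlonglongrightarrow> 0"
    proof (cases "emeasure M (space M) < \<infinity>")
      case True
      define \<mu> where "\<mu> = measure M (space M)"
      have \<mu>: "0 < \<mu>" using space_measure_pos[OF True] by (simp add: \<mu>_def)
      \<comment> \<open>The difference is 1_T/m(T) - 1/\<mu>, whose squared norm is 1/m(T) - 2/\<mu>
        + 1/\<mu>.\<close>
      have "L2_dist M ?h (\<lambda>y. haar_fun M B (exhaustion x n) y + c) =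
          sqrt (1 / measure M (exhaustion x n) - 1 / \<mu>)" for n
      proof -
        let ?T = "exhaustion x n"
        define m where "m = measure M ?T"
        have m: "0 < m" using ball_measure_pos[OF exhaustion_ball] by (simp add: m_def)
        have "(LINT y|M. (?h y - (haar_fun M B ?T y + c))\<^sup>2) =
            (LINT y|M. (1 / m * indicator ?T y + (- (1 / \<mu>)))\<^sup>2)"
          using True by (simp add: haar_fun_def c_def m_def \<mu>_def)
        also have "\<dots> = ((1 / m)\<^sup>2 + 2 * (1 / m) * (- (1 / \<mu>))) * m + (- (1 / \<mu>))\<^sup>2 * \<mu>"
          unfolding integral_ball_plus_const_square[OF True exhaustion_ball] m_def \<mu>_def ..
        also have "\<dots> = 1 / m - 1 / \<mu>" using m \<mu> by (simp add: field_simps power2_eq_square)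
        finally show ?thesis by (simp add: L2_dist_def m_def)
      qed
      moreover have "(\<lambda>n. sqrt (1 / measure M (exhaustion x n) - 1 / \<mu>)) \<longlonglongrightarrow> sqrt (1 / \<mu> - 1 / \<mu>)"
        using \<mu> measure_exhaustion_limit[OF True, of x, folded \<mu>_def]
        by (intro tendsto_intros) auto
      ultimately show ?thesis by simp
    next
      case False
      \<comment> \<open>Here c = 0 and the difference is 1_T/m(T), with squared norm 1/m(T).\<close>
      have "L2_dist M ?h (\<lambda>y. haar_fun M B (exhaustion x n) y + c) =
          sqrt (1 / measure M (exhaustion x n))" for n
      proof -
        let ?T = "exhaustion x n"
        have "(LINT y|M. (?h y - (haar_fun M B ?T y + c))\<^sup>2) =
            (LINT y|M. (1 / measure M ?T)\<^sup>2 * indicator ?T y)"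
          using False
          by (intro Bochner_Integration.integral_cong) (auto simp: haar_fun_def c_def indicator_def)
        also have "\<dots> = (1 / measure M ?T)\<^sup>2 * measure M ?T"
          by (simp add: space_M)
        finally show ?thesis by (simp add: L2_dist_def power2_eq_square)
      qed
      moreover have "(\<lambda>n. sqrt (1 / measure M (exhaustion x n))) \<longlonglongrightarrow> sqrt 0"
        by (intro tendsto_real_sqrt tendsto_divide_0[OF tendsto_const]
            filterlim_mono[OF measure_exhaustion_at_top[OF False] at_top_le_at_infinity order_refl])
      ultimately show ?thesis by simp
    qed
    have hB: "?h \<in> L2_closure M W"
    proof (rule L2_closure_LIMSEQ[OF WL L2_scale[OF ball_indicator_L2[OF B]] _ lim])
      show "\<forall>\<^sub>F n in sequentially. (\<lambda>y. haar_fun M B (exhaustion x n) y + c) \<in> L2_closure M W"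
        using exhausting_balls[OF B, of x]
      proof eventually_elim
        case (elim n)
        have "haar_fun M B (exhaustion x n) \<in> L2_closure M W"
          using haar_fun_in_subspace[OF W haar B exhaustion_ball elim] L2_closure_superset[OF WL] by auto
        from function_subspace_add_scale[OF clW this cW, of 1 1] show ?case by simp
      qed
    qed
    show ?thesis
      using function_subspace_add_scale[OF clW hB hB, of "measure M B" 0] ball_measure_pos[OF B]
      by simp
  qed
  show ?thesis
  proof (rule L2_dense_subset_closure[OF test_functions_dense WL subsetI])
    fix f :: "'a \<Rightarrow> real" assume "f \<in> test_functions"
    then show "f \<in> L2_closure M W"
    proof (induction rule: test_functions_induct)
      case zero
      then show ?case using clW by (simp add: function_subspace_def)
    next
      case (add a B g)
      from function_subspace_add_scale[OF clW ball[OF add(1)] add(3), of a 1] show ?case by simp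
    qed
  qed
qed

section \<open>Completeness of the Haar system\<close>

lemma predecessor_nontrivial:
  fixes B :: "'a set"
  shows "immediate_predecessor B' B \<Longrightarrow> B' \<in> nontrivial_balls"
  using nontrivial_of_psubset[of B B'] by (simp add: immediate_predecessor_def)

lemma haar_system_complete: "complete_system M (haar_system M)"
proof -
  have sub: "haar_system M \<subseteq> L2 M"
  proof
    fix f assume "f \<in> haar_system M"
    then consider B B' where "f = haar_fun M B B'" "immediate_predecessor B' B"
      | "f = (\<lambda>_. 1 / measure M (space M))" "emeasure M (space M) < \<infinity>"
      by (auto simp: haar_system_def split: if_splits)
    then show "f \<in> L2 M"
    proof cases
      case 1
      then have "B \<in> all_balls" "B' \<in> all_balls" by (auto simp: immediate_predecessor_def)
      then show ?thesis using haar_fun_test_function test_functions_L2 1 by auto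
    next
      case 2
      then show ?thesis using const_L2 by simp
    qed
  qed
  have spanL: "linear_span (haar_system M) \<subseteq> L2 M"
    by (rule linear_span_subset[OF function_subspace_L2 sub])
  have "L2_dense M (linear_span (haar_system M))"
  proof (rule dense_if_haar_fun_in[OF spanL function_subspace_linear_span])
    fix B B' :: "'a set" assume "immediate_predecessor B' B"
    then have "haar_fun M B B' \<in> haar_system M"
      using predecessor_nontrivial by (auto simp: haar_system_def)
    then show "haar_fun M B B' \<in> linear_span (haar_system M)"
      using linear_span_superset by auto
  next
    assume fin: "emeasure M (space M) < \<infinity>"
    then have c: "(\<lambda>_. 1 / measure M (space M)) \<in> linear_span (haar_system M)"
      using linear_span_superset[of "haar_system M"] by (auto simp: haar_system_def)
    have "(\<lambda>_. 1) \<in> linear_span (haar_system M)"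
      using function_subspace_add_scale[OF function_subspace_linear_span c c, of "measure M (space M)" 0]
        space_measure_pos[OF fin] by simp
    then show "(\<lambda>_. 1) \<in> L2_closure M (linear_span (haar_system M))"
      using L2_closure_superset[OF spanL] by auto
  qed
  then show ?thesis using sub by (simp add: complete_system_def)
qed

section \<open>Density of the range of L + 1\<close>

lemma chain_sum_exhaustion_limit: "(\<lambda>n. chain_sum (exhaustion x n)) \<longlonglongrightarrow> 0"
proof -
  let ?B = "exhaustion x 0"
  \<comment> \<open>Balls through x are nested, so those strictly containing the unit ball
    \<open>?B\<close> split into those inside the n-th ball and those strictly containing it. Thus
    \<open>chain_sum\<close> along the exhaustion is the tail of one convergent series.\<close>
  have eq: "chain_sum (exhaustion x n) = chain_sum ?B - sum C (chain_upto x ?B n)" for n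
  proof -
    have le: "?B \<subseteq> exhaustion x n" by (rule subset_ball) simp
    have un: "chain ?B = chain_upto x ?B n \<union> chain (exhaustion x n)"
    proof (intro set_eqI iffI)
      fix T assume T: "T \<in> chain ?B"
      have "x \<in> ?B" by simp
      then have "x \<in> T" using T unfolding chain_def by blast
      have "T \<subseteq> exhaustion x n \<or> exhaustion x n \<subseteq> T"
        by (rule all_balls_nested[OF chain_ball[OF T] exhaustion_ball \<open>x \<in> T\<close>]) simp
      then show "T \<in> chain_upto x ?B n \<union> chain (exhaustion x n)"
        using T unfolding chain_def chain_upto_def by blast
    next
      fix T assume "T \<in> chain_upto x ?B n \<union> chain (exhaustion x n)"
      then show "T \<in> chain ?B" using le unfolding chain_def chain_upto_def by blast
    qed
    have dis: "chain_upto x ?B n \<inter> chain (exhaustion x n) = {}"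
      unfolding chain_def chain_upto_def by blast
    have "chain_sum ?B = infsum C (chain_upto x ?B n) + chain_sum (exhaustion x n)"
      unfolding chain_sum_def un
      by (rule infsum_Un_disjoint[OF summable_on_finite[OF finite_chain_upto[OF exhaustion_ball]]
            C_summable_chain[OF exhaustion_ball] dis])
    then show ?thesis unfolding infsum_finite[OF finite_chain_upto[OF exhaustion_ball]] by linarith
  qed
  have "(\<lambda>n. chain_sum ?B - sum C (chain_upto x ?B n)) \<longlonglongrightarrow> chain_sum ?B - chain_sum ?B"
    unfolding chain_sum_def
    by (intro tendsto_intros has_sum_chain_LIMSEQ exhaustion_ball has_sum_infsum C_summable_chain)
  also have "(\<lambda>n. chain_sum ?B - sum C (chain_upto x ?B n)) = (\<lambda>n. chain_sum (exhaustion x n))"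
    by (rule ext) (rule eq[symmetric])
  finally show ?thesis by simp
qed

lemma hlambda_nonneg: "0 \<le> hlambda C B"
  unfolding hlambda_def by (intro infsum_nonneg less_imp_le C_pos) simp

text \<open>L + 1 multiplies a Haar function by \<open>hlambda C B' + 1\<close>, which is positive,
  so the Haar functions lie in the range. Constants need not be test functions and are only reached
  as limits of (L + 1) 1_T.\<close>

lemma laplacian_plus_one_dense: "L2_dense M ((\<lambda>u x. L u x + u x) ` test_functions)"
proof -
  let ?R = "(\<lambda>u x. L u x + u x) ` test_functions"
  have RL: "?R \<subseteq> L2 M"
    using laplacian_L2 test_functions_L2 by (auto intro!: L2_add)
  have R: "function_subspace ?R"
    unfolding function_subspace_def
  proof (intro conjI ballI allI)
    have "(\<lambda>_. 0) \<in> (test_functions :: ('a \<Rightarrow> real) set)"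
      by (rule function_subspace_zero[OF function_subspace_test_functions])
    then show "(\<lambda>_. 0) \<in> ?R"
      by (intro image_eqI[of _ _ "\<lambda>_. 0"]) (simp_all add: laplacian_zero)
  next
    fix f g and a b :: real assume "f \<in> ?R" "g \<in> ?R"
    then obtain u v where u: "u \<in> test_functions" "f = (\<lambda>x. L u x + u x)"
      and v: "v \<in> test_functions" "g = (\<lambda>x. L v x + v x)" by blast
    show "(\<lambda>x. a * f x + b * g x) \<in> ?R"
    proof (rule image_eqI)
      show "(\<lambda>x. a * u x + b * v x) \<in> test_functions"
        by (rule function_subspace_add_scale[OF function_subspace_test_functions u(1) v(1)])
      show "(\<lambda>x. a * f x + b * g x) =
          (\<lambda>x. L (\<lambda>x. a * u x + b * v x) x + (a * u x + b * v x))"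
        by (simp add: fun_eq_iff u(2) v(2) laplacian_lincomb[OF u(1) v(1)] algebra_simps)
    qed
  qed
  show ?thesis
  proof (rule dense_if_haar_fun_in[OF RL R])
    fix B B' :: "'a set" assume pred: "immediate_predecessor B' B"
    let ?f = "haar_fun M B B'"
    have "B \<in> all_balls" "B' \<in> all_balls" using pred by (auto simp: immediate_predecessor_def)
    then have f: "?f \<in> test_functions" by (rule haar_fun_test_function)
    have l: "0 < hlambda C B' + 1" using hlambda_nonneg[of B'] by simp
    have "(\<lambda>x. L ?f x + ?f x) \<in> ?R" using f by blast
    moreover have "(\<lambda>x. L ?f x + ?f x) = (\<lambda>x. (hlambda C B' + 1) * ?f x)"
      by (simp add: laplacian_haar_fun[OF predecessor_nontrivial[OF pred] pred] distrib_right)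
    ultimately have "(\<lambda>x. (hlambda C B' + 1) * ?f x) \<in> ?R" by simp
    from function_subspace_add_scale[OF R this this, of "1 / (hlambda C B' + 1)" 0] l
    show "?f \<in> ?R" by simp
  next
    assume fin: "emeasure M (space M) < \<infinity>"
    interpret finite_measure M using fin by (intro finite_measureI) simp
    define \<mu> where "\<mu> = measure M (space M)"
    define x :: 'a where "x = undefined"
    let ?T = "exhaustion x"
    let ?u = "\<lambda>n y. L (indicator (?T n)) y + indicator (?T n) y"
    have one: "(\<lambda>_. 1) \<in> L2 M" by (rule const_L2[OF fin])
    have TL: "indicator (?T n) \<in> L2 M" "L (indicator (?T n)) \<in> L2 M" for n
      using ball_indicator_L2[OF exhaustion_ball] laplacian_indicator_L2(1)[OF exhaustion_ball] .
    \<comment> \<open>1 - (L + 1) 1_T is the sum of 1 - 1_T, of squared norm m(X) - m(T), and of - L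
      1_T, where m(T) is estimated by \<mu> so that only the vanishing factor
      \<open>chain_sum\<close> depends on n.\<close>
    have bound: "L2_dist M (\<lambda>_. 1) (?u n) \<le>
        sqrt (\<mu> - measure M (?T n)) + sqrt (2 * \<mu> * (chain_sum (?T n))\<^sup>2)" for n
    proof -
      have "L2_dist M (\<lambda>_. 1) (?u n) \<le>
          L2_dist M (\<lambda>_. 1) (indicator (?T n)) + L2_dist M (indicator (?T n)) (?u n)"
        by (intro L2_dist_triangle one TL L2_add)
      moreover have "L2_dist M (\<lambda>_. 1) (indicator (?T n)) = sqrt (\<mu> - measure M (?T n))"
      proof -
        have "L2_dist M (\<lambda>_. 1) (indicator (?T n)) = sqrt (LINT y|M. ((- 1) * indicator (?T n) y + 1)\<^sup>2)"
          by (simp add: L2_dist_def)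
        then show ?thesis
          by (simp only: integral_ball_plus_const_square[OF fin exhaustion_ball]) (simp add: \<mu>_def)
      qed
      moreover have "L2_dist M (indicator (?T n)) (?u n) \<le> sqrt (2 * \<mu> * (chain_sum (?T n))\<^sup>2)"
      proof -
        have "(LINT y|M. (L (indicator (?T n)) y)\<^sup>2) \<le> 2 * measure M (?T n) * (chain_sum (?T n))\<^sup>2"
          by (rule laplacian_indicator_L2(2)[OF exhaustion_ball])
        also have "\<dots> \<le> 2 * \<mu> * (chain_sum (?T n))\<^sup>2"
          unfolding \<mu>_def by (intro mult_right_mono mult_left_mono bounded_measure) simp_all
        finally show ?thesis by (simp add: L2_dist_def)
      qed
      ultimately show ?thesis by linarith
    qed
    have "(\<lambda>n. sqrt (\<mu> - measure M (?T n)) + sqrt (2 * \<mu> * (chain_sum (?T n))\<^sup>2)) \<longlonglongrightarrow>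
        sqrt (\<mu> - \<mu>) + sqrt (2 * \<mu> * 0\<^sup>2)"
      using measure_exhaustion_limit[OF fin, of x, folded \<mu>_def]
      by (intro tendsto_intros chain_sum_exhaustion_limit)
    then have lim0: "(\<lambda>n. sqrt (\<mu> - measure M (?T n)) + sqrt (2 * \<mu> * (chain_sum (?T n))\<^sup>2)) \<longlonglongrightarrow> 0"
      by simp
    have lim: "(\<lambda>n. L2_dist M (\<lambda>_. 1) (?u n)) \<longlonglongrightarrow> 0"
      by (rule tendsto_sandwich[OF _ _ tendsto_const lim0])
        (use bound in \<open>auto simp: L2_dist_nonneg\<close>)
    have mem: "?u n \<in> L2_closure M ?R" for n
      using L2_closure_superset[OF RL] ball_indicator_test_function[OF exhaustion_ball, of x n] by blast
    show "(\<lambda>_. 1) \<in> L2_closure M ?R"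
      by (rule L2_closure_LIMSEQ[OF RL one always_eventually[OF allI[OF mem]] lim])
  qed
qed


text \<open>Locally constant functions that differ at a point differ on a ball about it, and balls
  have positive measure. So a class in L2 contains at most one test function, and \<open>L\<close>
  is well defined on classes.\<close>

lemma test_functions_eq_AE:
  assumes f: "f \<in> test_functions" and g: "g \<in> test_functions" and ae: "AE x in M. f x = g x"
  shows "f = g"
proof (rule ccontr)
  assume "f \<noteq> g"
  then obtain z where z: "f z \<noteq> g z" by auto
  obtain U V where U: "open U" "z \<in> U" "f constant_on U" and V: "open V" "z \<in> V" "g constant_on V"
    using f g unfolding test_functions_def locally_constant_def by blast
  have "open (U \<inter> V)" "z \<in> U \<inter> V" using U V by auto
  then obtain r where r: "0 < r" "ball z r \<subseteq> U \<inter> V" by (rule openE)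
  have ne: "f y \<noteq> g y" if "y \<in> ball z r" for y
  proof -
    have "f y = f z" "g y = g z" using that U V r unfolding constant_on_def by auto
    then show ?thesis using z by simp
  qed
  obtain N where N: "{x \<in> space M. \<not> f x = g x} \<subseteq> N" "emeasure M N = 0" "N \<in> sets M"
    using AE_E[OF ae] by blast
  have "ball z r \<subseteq> N" using ne N(1) by (auto simp: space_M)
  then have "emeasure M (ball z r) \<le> 0" using emeasure_mono[of "ball z r" N M] N by simp
  then show False
    using ball_measure_pos[OF ball_in_all_balls[OF r(1), of z]] by (simp add: measure_def)
qed

lemma laplacian_L2_operator: "L2_operator M L test_functions"
  unfolding L2_operator_def
proof (intro conjI ballI allI impI)
  show "test_functions \<subseteq> L2 M" by (rule test_functions_L2)
  show "(test_functions :: ('a \<Rightarrow> real) set) \<noteq> {}"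
    using function_subspace_zero[OF function_subspace_test_functions] by auto
  show "L f \<in> L2 M" if "f \<in> test_functions" for f using that by (rule laplacian_L2)
  show "AE x in M. L f x = L g x"
    if "f \<in> test_functions" "g \<in> test_functions" "AE x in M. f x = g x" for f g
    using test_functions_eq_AE[OF that] by simp
  show "(\<lambda>x. a * f x + b * g x) \<in> test_functions"
    if "f \<in> test_functions" "g \<in> test_functions" for f g :: "'a \<Rightarrow> real" and a b
    by (rule function_subspace_add_scale[OF function_subspace_test_functions that])
  show "AE x in M. L (\<lambda>y. a * f y + b * g y) x = a * L f x + b * L g x"
    if "f \<in> test_functions" "g \<in> test_functions" for f g a b
    by (simp add: laplacian_lincomb[OF that])
qed

lemma laplacian_essentially_self_adjoint: "essentially_self_adjoint M L test_functions"
  by (intro essentially_self_adjointI laplacian_L2_operator test_functions_dense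
      laplacian_symmetric laplacian_nonneg laplacian_plus_one_dense)

end

theorem proposition3p3:
  fixes M :: "'a::metric_space measure" and C :: "'a set \<Rightarrow> real"
  assumes "ultrametric TYPE('a)"
    and "locally_compact_space (euclidean :: 'a topology)"
    and "separable_space (euclidean :: 'a topology)"
    and "proper_metric TYPE('a)"
    and "radon_measure M"
    and "\<And>B. B \<in> all_balls \<Longrightarrow> 0 < diameter B \<Longrightarrow> 0 < emeasure M B"
    and "\<And>x. emeasure M {x} = 0 \<longleftrightarrow> \<not> x isolated_in UNIV"
    and "choice_function C"
  shows "complete_system M (haar_system M) \<and>
         (\<forall>B'\<in>nontrivial_balls. \<forall>B. immediate_predecessor B' B \<longrightarrow>
           (\<forall>x. hierarchical_laplacian M C (haar_fun M B B') x = hlambda C B' * haar_fun M B B' x)) \<and>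
         L2_operator M (hierarchical_laplacian M C) test_functions \<and>
         nonneg_definite M (hierarchical_laplacian M C) test_functions \<and>
         essentially_self_adjoint M (hierarchical_laplacian M C) test_functions"
proof -
  interpret hierarchical_space M C
    using assms by unfold_locales auto
  show ?thesis
    by (intro conjI ballI allI impI haar_system_complete laplacian_haar_fun laplacian_L2_operator
        laplacian_nonneg laplacian_essentially_self_adjoint)
qed

end
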